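(* Let $\bar x$ be a critical point of the finite-max composite function $f=g\circ F$, let $\bar z=F(\bar x)$, let $\mathcal M=F^{-1}(\mathcal E)$ be the locally minimal identifiable set for $f$ at $\bar x$ for $0$ described in the context, and let $\mathscr Z$ be a compatible stratification of $\mathcal E$ near $\bar z$. Suppose that the activity hypothesis ("$\mathcal M$ is a $C^2$ identifiable manifold for $f$ at $\bar x$ for $0$") implies the existence of a linear subspace $\mathcal W\subseteq T_{\bar x}\mathcal M$ and two strata $\mathcal Z_1,\mathcal Z_2\in\mathscr Z$ such that (a) both $\mathcal Z_1$ and $\mathcal Z_2$ are accessible from $\mathcal M$ at $\bar x$ along $\mathcal W$; and (b) their branch quadratics disagree: $\zeta_{\mathcal Z_1,\mathcal W}\not\equiv\zeta_{\mathcal Z_2,\mathcal W}$ on $\mathcal W$. Then $f$ admits no $C^2$ identifiable manifold at $\bar x$ for $0\in\partial f(\bar x)$; that is, $\bar x$ is inactive.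
   Context: Setting. Fix an o-minimal structure on the real field; "definable" refers to it. Let $\mathcal I$ be a finite index set, $F:\mathbb R^d\to\mathbb R^n$ a $C^2$ definable map, $g_i:\mathbb R^n\to\mathbb R$ ($i\in\mathcal I$) $C^2$ definable functions, $g(z)=\max_{i\in\mathcal I}g_i(z)$, and $f=g\circ F$ (a finite-max composite function). The active set at $z$ is $I(z)=\{i\in\mathcal I: g_i(z)=g(z)\}$. $\partial$ denotes the limiting subdifferential, and $\bar x$ is critical for $f$ if $0\in\partial f(\bar x)$. Identifiability. For locally Lipschitz $h$ and $\bar v\in\partial h(\bar x)$, a set $\mathcal M\ni\bar x$ is identifiable for $h$ at $\bar x$ for $\bar v$ if for all sequences $x_\nu\to\bar x$, $v_\nu\to\bar v$ with $v_\nu\in\partial h(x_\nu)$ one has $x_\nu\in\mathcal M$ for all large $\nu$. It is locally minimal if for every other identifiable set $\mathcal N$ for the same pair there is a neighborhood $\mathcal O$ of $\bar x$ with $\mathcal M\cap\mathcal O\subseteq\mathcal N\cap\mathcal O$. It is a $C^2$ identifiable manifold if it is identifiable and, near $\bar x$, is a $C^2$ embedded submanifold on which $h$ restricts to a $C^2$ function. A critical point $\bar x$ of $h$ is inactive if no $C^2$ identifiable manifold exists for $h$ at $\bar x$ for $0$. The set $\mathcal M$. Let $\Delta_{\mathcal I}=\{\lambda\in\mathbb R_+^{\mathcal I}:\sum_i\lambda_i=1\}$, $\Lambda_0=\{\lambda\in\Delta_{\mathcal I}:\operatorname{supp}\lambda\subseteq I(\bar z),\ DF(\bar x)^*(\sum_{i\in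 I(\bar z)}\lambda_i\nabla g_i(\bar z))=0\}$, $\mathscr K=\{\operatorname{supp}\lambda:\lambda\in\Lambda_0\}$, $\mathcal A_{\mathcal K}=\{z:\mathcal K\subseteq I(z)\}$, $\mathcal E=\bigcup_{\mathcal K\in\mathscr K}\mathcal A_{\mathcal K}$. Then $\mathcal M=F^{-1}(\mathcal E)$ is the locally minimal identifiable set for $f$ at $\bar x$ for $0$. Stratification. A $C^2$ stratification of a set is a partition into finitely many connected $C^2$ embedded submanifolds (strata) such that whenever a stratum $\mathcal Y$ meets the closure of a stratum $\mathcal X$, $\mathcal Y\subseteq\operatorname{cl}\mathcal X$. A compatible stratification $\mathscr Z$ is a $C^2$ stratification of $\mathcal E$ in a neighborhood of $\bar z$ such that each stratum is contained in or disjoint from each set $\{z:I(z)=\mathcal J\}$, $\mathcal J\subseteq I(\bar z)$; equivalently, each stratum $\mathcal Z\in\mathscr Z$ has a set $\mathcal I_{\mathcal Z}\subseteq I(\bar z)$ with $I(z)=\mathcal I_{\mathcal Z}$ for all $z\in\mathcal Z$. Objects defined under the activity hypothesis. Let $\gamma$ be a $C^2$ map from a neighborhood of $0$ in $T_{\bar x}\mathcal M$ onto a neighborhood of $\bar x$ in $\mathcal M$, $\gamma(0)=\bar x$, of the form $\gamma(v)=\bar x+v+Z_{\mathcal M}(v)+o(\|v\|^2)$ with $Z_{\mathcal M}:T_{\bar x}\mathcal M\to N_{\bar x}\mathcal M$ a homogeneous quadratic map into the normal space (such a map exists). For $v\in T_{\bar x}\mathcal M$ and $i\in I(\bar z)$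 put $\eta_{\mathcal M}(v)=DF(\bar x)[Z_{\mathcal M}(v)]+\tfrac12D^2F(\bar x)[v,v]$ and $\zeta_i(v)=\langle\nabla g_i(\bar z),\eta_{\mathcal M}(v)\rangle+\tfrac12\langle DF(\bar x)[v],\nabla^2g_i(\bar z)DF(\bar x)[v]\rangle$. For a linear subspace $\mathcal W\subseteq T_{\bar x}\mathcal M$, a stratum $\mathcal Z\in\mathscr Z$ is accessible from $\mathcal M$ at $\bar x$ along $\mathcal W$ if there is a nonempty relatively open cone $\mathcal C\subset\mathcal W\setminus\{0\}$ such that for every unit $v\in\mathcal C$ there is $\varepsilon(v)>0$ with $F(\gamma(tv))\in\mathcal Z$ for $0<t<\varepsilon(v)$. For an accessible stratum, the restrictions $\zeta_i|_{\mathcal W}$, $i\in\mathcal I_{\mathcal Z}$, all coincide; the common quadratic form is the branch quadratic $\zeta_{\mathcal Z,\mathcal W}$. *)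

theory Defs
  imports "HOL-Analysis.Analysis" "HOL-Library.Disjoint_Sets"
begin

section \<open>O-minimal structures on the real field\<close>

text \<open>
  A structure is a sequence \<open>S\<close> where \<open>S n\<close> is a family of subsets of the n-dimensional
  real space; points of that space are lists of length \<open>n\<close>. The axioms are van den Dries':
  Boolean algebras, cylinders, diagonals, projections, the order, the graphs of addition and
  multiplication, and o-minimality. A subset of the line is a finite union of points and open
  intervals iff it is a finite union of order-convex sets.
\<close>

definition o_minimal_structure :: "(nat \<Rightarrow> real list set set) \<Rightarrow> bool" where
  "o_minimal_structure S \<longleftrightarrow>
     (\<forall>n. \<forall>A\<in>S n. \<forall>xs\<in>A. length xs = n) \<and>
     (\<forall>n. {} \<in> S n) \<and>
     (\<forall>n. \<forall>A\<in>S n. \<forall>B\<in>S n. A \<union> B \<in> S n) \<and>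
     (\<forall>n. \<forall>A\<in>S n. {xs. length xs = n} - A \<in> S n) \<and>
     (\<forall>n. \<forall>A\<in>S n. {xs @ [t] | xs t. xs \<in> A} \<in> S (Suc n) \<and> {t # xs | xs t. xs \<in> A} \<in> S (Suc n)) \<and>
     (\<forall>n i j. i < n \<longrightarrow> j < n \<longrightarrow> {xs. length xs = n \<and> xs ! i = xs ! j} \<in> S n) \<and>
     (\<forall>n. \<forall>A\<in>S (Suc n). butlast ` A \<in> S n) \<and>
     {[s, t] | s t. s < t} \<in> S 2 \<and>
     {[s, t, s + t] | s t. True} \<in> S 3 \<and>
     {[s, t, s * t] | s t. True} \<in> S 3 \<and>
     (\<forall>A. {[t] | t. t \<in> A} \<in> S 1 \<longleftrightarrow> (\<exists>C. finite C \<and> (\<forall>J\<in>C. is_interval J) \<and> A = \<Union>C))"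

text \<open>
  The coordinate list depends on an enumeration of the basis, but definability does not, since
  structures are closed under permutation of coordinates.
\<close>

definition coords :: "'a::euclidean_space \<Rightarrow> real list" where
  "coords x = map (\<lambda>k. x \<bullet> from_nat_into Basis k) [0..<DIM('a)]"

definition definable_map ::
    "(nat \<Rightarrow> real list set set) \<Rightarrow> ('a::euclidean_space \<Rightarrow> 'b::euclidean_space) \<Rightarrow> bool" where
  "definable_map S f \<longleftrightarrow> {coords x @ coords (f x) | x. True} \<in> S (DIM('a) + DIM('b))"


section \<open>Second-order calculus\<close>

definition C2_on_open :: "'a set \<Rightarrow> ('a::real_normed_vector \<Rightarrow> 'b::real_normed_vector) \<Rightarrow> bool" where
  "C2_on_open V f \<longleftrightarrow> open V \<and>
     (\<exists>(f' :: 'a \<Rightarrow> 'a \<Rightarrow>\<^sub>L 'b) (f'' :: 'a \<Rightarrow> 'a \<Rightarrow>\<^sub>L 'a \<Rightarrow>\<^sub>L 'b).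
        (\<forall>x\<in>V. (f has_derivative blinfun_apply (f' x)) (at x)) \<and>
        (\<forall>x\<in>V. (f' has_derivative blinfun_apply (f'' x)) (at x)) \<and>
        continuous_on V f'')"

text \<open>On an arbitrary set, twice continuous differentiability means local extendability.\<close>

definition C2_on :: "'a set \<Rightarrow> ('a::real_normed_vector \<Rightarrow> 'b::real_normed_vector) \<Rightarrow> bool" where
  "C2_on S f \<longleftrightarrow> (\<forall>x\<in>S. \<exists>V h. x \<in> V \<and> C2_on_open V h \<and> (\<forall>y\<in>S \<inter> V. h y = f y))"

abbreviation deriv1 :: "('a::real_normed_vector \<Rightarrow> 'b::real_normed_vector) \<Rightarrow> 'a \<Rightarrow> 'a \<Rightarrow> 'b" where
  "deriv1 f x \<equiv> frechet_derivative f (at x)"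

definition deriv2 ::
    "('a::real_normed_vector \<Rightarrow> 'b::real_normed_vector) \<Rightarrow> 'a \<Rightarrow> 'a \<Rightarrow> 'a \<Rightarrow> 'b" where
  "deriv2 f x u v = deriv1 (\<lambda>y. deriv1 f y u) x v"

definition gradient :: "('a::real_inner \<Rightarrow> real) \<Rightarrow> 'a \<Rightarrow> 'a" where
  "gradient h x = (THE d. GDERIV h x :> d)"

definition hessian :: "('a::real_inner \<Rightarrow> real) \<Rightarrow> 'a \<Rightarrow> 'a \<Rightarrow> 'a" where
  "hessian h x = deriv1 (gradient h) x"


section \<open>Embedded submanifolds\<close>

definition C2_submanifold :: "'a::euclidean_space set \<Rightarrow> bool" where
  "C2_submanifold X \<longleftrightarrow>
     (\<exists>k. \<forall>p\<in>X. \<exists>U V \<phi> \<psi> L. p \<in> U \<and> C2_on_open U \<phi> \<and> C2_on_open V (\<psi> :: 'a \<Rightarrow> 'a) \<and>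
        homeomorphism U V \<phi> \<psi> \<and> subspace L \<and> dim L = k \<and> \<phi> ` (X \<inter> U) = L \<inter> V)"

definition tangent_space :: "'a::euclidean_space set \<Rightarrow> 'a \<Rightarrow> 'a set" where
  "tangent_space X x =
     {v. \<exists>c \<epsilon>. 0 < \<epsilon> \<and> C2_on {-\<epsilon><..<\<epsilon>::real} c \<and> c ` {-\<epsilon><..<\<epsilon>} \<subseteq> X \<and> c 0 = x \<and>
        (c has_vector_derivative v) (at 0)}"

abbreviation normal_space :: "'a::euclidean_space set \<Rightarrow> 'a \<Rightarrow> 'a set" where
  "normal_space X x \<equiv> orthogonal_comp (tangent_space X x)"


section \<open>Limiting subdifferential and identifiability\<close>

definition regular_subdifferential :: "('a::euclidean_space \<Rightarrow> real) \<Rightarrow> 'a \<Rightarrow> 'a set" where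
  "regular_subdifferential h x =
     {v. \<forall>\<epsilon>>0. \<forall>\<^sub>F y in at x. h y \<ge> h x + v \<bullet> (y - x) - \<epsilon> * norm (y - x)}"

definition limiting_subdifferential :: "('a::euclidean_space \<Rightarrow> real) \<Rightarrow> 'a \<Rightarrow> 'a set" where
  "limiting_subdifferential h x =
     {v. \<exists>xs vs. xs \<longlonglongrightarrow> x \<and> (\<lambda>\<nu>. h (xs \<nu>)) \<longlonglongrightarrow> h x \<and>
        (\<forall>\<nu>. vs \<nu> \<in> regular_subdifferential h (xs \<nu>)) \<and> vs \<longlonglongrightarrow> v}"

definition critical_point :: "('a::euclidean_space \<Rightarrow> real) \<Rightarrow> 'a \<Rightarrow> bool" where
  "critical_point h x \<longleftrightarrow> 0 \<in> limiting_subdifferential h x"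

text \<open>
  The notions below are meant for locally Lipschitz \<open>h\<close>; the composite functions considered
  here are locally Lipschitz automatically.
\<close>

definition identifiable :: "('a::euclidean_space \<Rightarrow> real) \<Rightarrow> 'a \<Rightarrow> 'a \<Rightarrow> 'a set \<Rightarrow> bool" where
  "identifiable h x v M \<longleftrightarrow> v \<in> limiting_subdifferential h x \<and> x \<in> M \<and>
     (\<forall>xs vs. xs \<longlonglongrightarrow> x \<longrightarrow> vs \<longlonglongrightarrow> v \<longrightarrow>
        (\<forall>\<nu>. vs \<nu> \<in> limiting_subdifferential h (xs \<nu>)) \<longrightarrow> (\<forall>\<^sub>F \<nu> in sequentially. xs \<nu> \<in> M))"

definition C2_identifiable_manifold ::
    "('a::euclidean_space \<Rightarrow> real) \<Rightarrow> 'a \<Rightarrow> 'a \<Rightarrow> 'a set \<Rightarrow> bool" where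
  "C2_identifiable_manifold h x v M \<longleftrightarrow> identifiable h x v M \<and>
     (\<exists>U. open U \<and> x \<in> U \<and> C2_submanifold (M \<inter> U) \<and> C2_on (M \<inter> U) h)"

definition inactive :: "('a::euclidean_space \<Rightarrow> real) \<Rightarrow> 'a \<Rightarrow> bool" where
  "inactive h x \<longleftrightarrow> critical_point h x \<and> \<not> (\<exists>M. C2_identifiable_manifold h x 0 M)"


section \<open>Finite-max composite functions\<close>

definition max_fun :: "('i::finite \<Rightarrow> 'b \<Rightarrow> real) \<Rightarrow> 'b \<Rightarrow> real" where
  "max_fun g z = Max (range (\<lambda>i. g i z))"

definition active_set :: "('i::finite \<Rightarrow> 'b \<Rightarrow> real) \<Rightarrow> 'b \<Rightarrow> 'i set" where
  "active_set g z = {i. g i z = max_fun g z}"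

definition supp :: "('i \<Rightarrow> real) \<Rightarrow> 'i set" where
  "supp l = {i. l i \<noteq> 0}"

definition std_simplex :: "('i::finite \<Rightarrow> real) set" where
  "std_simplex = {l. (\<forall>i. 0 \<le> l i) \<and> (\<Sum>i\<in>UNIV. l i) = 1}"

context
  fixes F :: "'a::euclidean_space \<Rightarrow> 'b::euclidean_space"
    and g :: "'i::finite \<Rightarrow> 'b \<Rightarrow> real"
    and xbar :: 'a
begin

definition multipliers :: "('i \<Rightarrow> real) set" where
  "multipliers = {l \<in> std_simplex. supp l \<subseteq> active_set g (F xbar) \<and>
     adjoint (deriv1 F xbar) (\<Sum>i\<in>active_set g (F xbar). l i *\<^sub>R gradient (g i) (F xbar)) = 0}"

definition critical_active_region :: "'b set" where
  "critical_active_region = (\<Union>K\<in>supp ` multipliers. {z. K \<subseteq> active_set g z})"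

definition minimal_identifiable_set :: "'a set" where
  "minimal_identifiable_set = F -` critical_active_region"

end


section \<open>Compatible stratifications\<close>

definition C2_stratification :: "'b::euclidean_space set \<Rightarrow> 'b set set \<Rightarrow> bool" where
  "C2_stratification E \<Z> \<longleftrightarrow> partition_on E \<Z> \<and> finite \<Z> \<and>
     (\<forall>Z\<in>\<Z>. connected Z \<and> C2_submanifold Z) \<and>
     (\<forall>X\<in>\<Z>. \<forall>Y\<in>\<Z>. Y \<inter> closure X \<noteq> {} \<longrightarrow> Y \<subseteq> closure X)"

definition compatible_stratification ::
    "('i::finite \<Rightarrow> 'b::euclidean_space \<Rightarrow> real) \<Rightarrow> 'b set \<Rightarrow> 'b \<Rightarrow> 'b set set \<Rightarrow> bool" where
  "compatible_stratification g E zbar \<Z> \<longleftrightarrow>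
     (\<exists>U. open U \<and> zbar \<in> U \<and> C2_stratification (E \<inter> U) \<Z>) \<and>
     (\<forall>Z\<in>\<Z>. \<forall>J. J \<subseteq> active_set g zbar \<longrightarrow>
        Z \<subseteq> {z. active_set g z = J} \<or> Z \<inter> {z. active_set g z = J} = {})"

text \<open>
  Well defined for the strata of a compatible stratification that meet a sufficiently small
  neighbourhood of the base point, in particular for all accessible ones.
\<close>

definition stratum_index :: "('i::finite \<Rightarrow> 'b \<Rightarrow> real) \<Rightarrow> 'b set \<Rightarrow> 'i set" where
  "stratum_index g Z = (THE J. \<forall>z\<in>Z. active_set g z = J)"


section \<open>Second-order data of the identifiable manifold\<close>

text \<open>
  \<open>Q\<close> is the homogeneous quadratic map from the tangent to the normal space; only its values
  on the tangent space matter. Neighbourhoods of the base point in \<open>M\<close> are relative.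
\<close>

definition second_order_parametrization ::
    "'a::euclidean_space set \<Rightarrow> 'a \<Rightarrow> ('a \<Rightarrow> 'a) \<Rightarrow> ('a \<Rightarrow> 'a) \<Rightarrow> bool" where
  "second_order_parametrization M xbar \<gamma> Q \<longleftrightarrow>
     (\<exists>U. openin (top_of_set (tangent_space M xbar)) U \<and> 0 \<in> U \<and> C2_on U \<gamma> \<and> \<gamma> ` U \<subseteq> M \<and>
        (\<exists>V. open V \<and> xbar \<in> V \<and> M \<inter> V \<subseteq> \<gamma> ` U)) \<and>
     \<gamma> 0 = xbar \<and>
     (\<exists>B. bilinear B \<and> (\<forall>v\<in>tangent_space M xbar. Q v = B v v)) \<and>
     (\<forall>v\<in>tangent_space M xbar. Q v \<in> normal_space M xbar) \<and>
     ((\<lambda>v. (\<gamma> v - (xbar + v + Q v)) /\<^sub>R (norm v)\<^sup>2) \<longlongrightarrow> 0) (at 0 within tangent_space M xbar)"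

text \<open>The library's \<^const>\<open>cone\<close> contains the origin, hence the explicit positive homogeneity.\<close>

definition accessible ::
    "('a::euclidean_space \<Rightarrow> 'b) \<Rightarrow> ('a \<Rightarrow> 'a) \<Rightarrow> 'a set \<Rightarrow> 'b set \<Rightarrow> bool" where
  "accessible F \<gamma> W Z \<longleftrightarrow>
     (\<exists>C. C \<noteq> {} \<and> C \<subseteq> W - {0} \<and> openin (top_of_set W) C \<and>
        (\<forall>v\<in>C. \<forall>c>0. c *\<^sub>R v \<in> C) \<and>
        (\<forall>v\<in>C. norm v = 1 \<longrightarrow> (\<exists>\<epsilon>>0. \<forall>t. 0 < t \<and> t < \<epsilon> \<longrightarrow> F (\<gamma> (t *\<^sub>R v)) \<in> Z)))"

context
  fixes F :: "'a::euclidean_space \<Rightarrow> 'b::euclidean_space"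
    and g :: "'i::finite \<Rightarrow> 'b \<Rightarrow> real"
    and xbar :: 'a
    and Q :: "'a \<Rightarrow> 'a"
begin

definition eta :: "'a \<Rightarrow> 'b" where
  "eta v = deriv1 F xbar (Q v) + (1/2) *\<^sub>R deriv2 F xbar v v"

definition zeta :: "'i \<Rightarrow> 'a \<Rightarrow> real" where
  "zeta i v = gradient (g i) (F xbar) \<bullet> eta v
     + (1/2) * (deriv1 F xbar v \<bullet> hessian (g i) (F xbar) (deriv1 F xbar v))"

text \<open>
  The common value at \<open>v\<close> of the \<^const>\<open>zeta\<close> functions indexed by the stratum; it exists whenever \<open>Z\<close>
  is accessible along a subspace containing \<open>v\<close>. The branch quadratic of \<open>Z\<close> and \<open>W\<close> is this
  function restricted to \<open>W\<close>.
\<close>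

definition branch_quadratic :: "'b set \<Rightarrow> 'a \<Rightarrow> real" where
  "branch_quadratic Z v = (THE q. \<forall>i\<in>stratum_index g Z. zeta i v = q)"

end

end

theory Submission
  imports Defs
begin

text \<open>
  Suppose some \<open>C2\<close> identifiable manifold \<open>M'\<close> for \<open>0\<close> exists at the critical point. The
  argument shows that the set \<open>M\<close> of the theorem is then itself such a manifold, and that along
  \<open>M\<close> there is only one second-order coefficient available, so that the branch quadratics of two
  accessible strata cannot disagree.

  \<^bold>\<open>From some manifold to \<open>M\<close>.\<close> Identifiability says that points near \<open>xbar\<close> carrying a small
  subgradient lie in the set. For \<open>M\<close> this follows from the formula for the subdifferential of a
  finite maximum as the convex hull of the active gradients: limits of multipliers are
  multipliers at \<open>xbar\<close>, and a limit has smaller support (\<open>identifiable_critical_region\<close>). Two sets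
  agree near \<open>xbar\<close> as soon as each is contained in the other locally. Near \<open>xbar\<close> the set \<open>M\<close> lies
  in every identifiable set, because only finitely many supports occur and, for one critical
  multiplier per support, the same convex combination of gradients taken at a nearby point of \<open>M\<close>
  is a small subgradient there (\<open>critical_region_locally_minimal\<close>).

  The manifold \<open>M'\<close> lies in every identifiable set as well
  (\<open>identifiable_manifold_locally_minimal\<close>). The task is to find, at a point \<open>x'\<close> of \<open>M'\<close>, a small
  subgradient. Extend the restriction of \<open>f\<close> to a function \<open>k\<close> with Lipschitz gradient by
  precomposing with a retraction onto \<open>M'\<close>, and let \<open>v\<close> be the gradient of \<open>k\<close> at \<open>x'\<close>; it is small
  because \<open>f\<close> has, up to a quadratic term, a local minimum at \<open>xbar\<close>. Now minimize
  \<open>f y - v \<bullet> (y - x') + K |y - x'|^2\<close> for a large constant \<open>K\<close>. The minimizer \<open>y\<close> is close to \<open>xbar\<close>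
  and carries the small subgradient \<open>v - 2 K (y - x')\<close>, so it belongs to \<open>M'\<close>. On \<open>M'\<close>, however,
  \<open>f\<close> agrees with \<open>k\<close>, and with \<open>k\<close> in place of \<open>f\<close> the only minimizer near \<open>xbar\<close> is \<open>x'\<close>. Hence
  \<open>y = x'\<close>, and \<open>v\<close> is a subgradient of \<open>f\<close> at \<open>x'\<close>.

  \<^bold>\<open>Comparing the branches.\<close> Near \<open>xbar\<close> the restriction of \<open>f\<close> to \<open>M\<close> extends to a \<open>C2\<close> function
  \<open>k\<close>. If the curve \<open>t \<mapsto> \<gamma> (t v)\<close> is mapped into a stratum whose points have active set \<open>J\<close>, then
  \<open>k\<close> agrees along it with \<open>g i \<circ> F\<close> for each \<open>i\<close> in \<open>J\<close>. Comparing the second-order coefficients of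
  both functions along the curve gives \<open>zeta i v = Dk(Q v) + D2k(v,v)/2\<close>, whose right-hand side does
  not refer to the stratum. The identity holds on a relatively open cone of \<open>W\<close>; both sides are
  quadratic forms, so it holds on \<open>W\<close> (\<open>zeta_eq_restriction_coefficient\<close>). Every accessible
  stratum thus has the same branch quadratic.
\<close>

section \<open>Functions with locally Lipschitz derivative\<close>

text \<open>
  Only Lipschitz bounds on the derivative are needed to compare a function with its
  linearization up to a quadratic error, and unlike \<open>C2\<close> regularity in terms of iterated bounded
  linear maps they pass through compositions with little effort.
\<close>

definition C11_at :: "('a::real_normed_vector \<Rightarrow> 'b::real_normed_vector) \<Rightarrow> 'a \<Rightarrow> bool" where
  "C11_at f x \<longleftrightarrow> (\<exists>\<delta>>0. \<exists>K. \<exists>f' :: 'a \<Rightarrow> 'a \<Rightarrow>\<^sub>L 'b. \<forall>y\<in>ball x \<delta>.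
     (f has_derivative blinfun_apply (f' y)) (at y) \<and>
     (\<forall>z\<in>ball x \<delta>. norm (f' z - f' y) \<le> K * norm (z - y)))"

lemma C11_atI:
  fixes f' :: "'a::real_normed_vector \<Rightarrow> 'a \<Rightarrow>\<^sub>L 'b::real_normed_vector"
  assumes "0 < \<delta>" and "\<And>y. y \<in> ball x \<delta> \<Longrightarrow> (f has_derivative blinfun_apply (f' y)) (at y)"
    and "\<And>y z. y \<in> ball x \<delta> \<Longrightarrow> z \<in> ball x \<delta> \<Longrightarrow> norm (f' z - f' y) \<le> K * norm (z - y)"
  shows "C11_at f x"
  unfolding C11_at_def using assms by blast

text \<open>
  A single constant serves as Lipschitz constant of the derivative, bound on its norm, and
  Lipschitz constant of the function, after enlarging the constant of the definition.
\<close>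

lemma C11_atE:
  fixes f :: "'a::real_normed_vector \<Rightarrow> 'b::real_normed_vector"
  assumes "C11_at f x"
  obtains \<delta> K and f' :: "'a \<Rightarrow> 'a \<Rightarrow>\<^sub>L 'b" where "0 < \<delta>" "0 \<le> K"
    "\<And>y. y \<in> ball x \<delta> \<Longrightarrow> (f has_derivative blinfun_apply (f' y)) (at y)"
    "\<And>y z. y \<in> ball x \<delta> \<Longrightarrow> z \<in> ball x \<delta> \<Longrightarrow> norm (f' z - f' y) \<le> K * norm (z - y)"
    "\<And>y. y \<in> ball x \<delta> \<Longrightarrow> norm (f' y) \<le> K"
    "\<And>y z. y \<in> ball x \<delta> \<Longrightarrow> z \<in> ball x \<delta> \<Longrightarrow> norm (f z - f y) \<le> K * norm (z - y)"
proof -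
  obtain \<delta> K and f' :: "'a \<Rightarrow> 'a \<Rightarrow>\<^sub>L 'b" where d: "0 < \<delta>"
    and der: "\<And>y. y \<in> ball x \<delta> \<Longrightarrow> (f has_derivative blinfun_apply (f' y)) (at y)"
    and lip: "\<And>y z. y \<in> ball x \<delta> \<Longrightarrow> z \<in> ball x \<delta> \<Longrightarrow> norm (f' z - f' y) \<le> K * norm (z - y)"
    using assms unfolding C11_at_def by blast
  define A where "A = norm (f' x) + \<bar>K\<bar> * (1 + \<delta>)"
  have KA: "K \<le> A"
    using d by (simp add: A_def algebra_simps) (smt (verit) norm_ge_zero mult_nonneg_nonneg)
  have "0 \<le> A" using d by (simp add: A_def)
  have bound: "norm (f' y) \<le> A" if y: "y \<in> ball x \<delta>" for y
  proof -
    have "norm (f' y) \<le> norm (f' x) + norm (f' y - f' x)" by (metis norm_triangle_sub)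
    also have "norm (f' y - f' x) \<le> K * norm (y - x)" using lip[of x y] d y by simp
    also have "\<dots> \<le> \<bar>K\<bar> * (1 + \<delta>)"
      using y d by (intro mult_mono) (auto simp: dist_norm norm_minus_commute)
    finally show ?thesis by (simp add: A_def)
  qed
  have fl: "norm (f z - f y) \<le> A * norm (z - y)" if "y \<in> ball x \<delta>" "z \<in> ball x \<delta>" for y z
  proof (rule differentiable_bound[OF convex_ball[of x \<delta>], where f' = "\<lambda>y. blinfun_apply (f' y)"])
    show "(f has_derivative blinfun_apply (f' w)) (at w within ball x \<delta>)" if "w \<in> ball x \<delta>" for w
      using der[OF that] has_derivative_at_withinI by blast
    show "onorm (blinfun_apply (f' w)) \<le> A" if "w \<in> ball x \<delta>" for w
      using bound[OF that] by (simp add: norm_blinfun.rep_eq)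
  qed (use that in auto)
  have "norm (f' z - f' y) \<le> A * norm (z - y)" if "y \<in> ball x \<delta>" "z \<in> ball x \<delta>" for y z
    using lip[OF that] KA by (meson mult_right_mono norm_ge_zero order_trans)
  then show thesis using that[OF d \<open>0 \<le> A\<close> der _ bound fl] by blast
qed

lemma C2_on_open_imp_C11_at:
  fixes f :: "'a::real_normed_vector \<Rightarrow> 'b::real_normed_vector"
  assumes "C2_on_open V f" and "x \<in> V"
  shows "C11_at f x"
proof -
  obtain f' :: "'a \<Rightarrow> 'a \<Rightarrow>\<^sub>L 'b" and f'' :: "'a \<Rightarrow> 'a \<Rightarrow>\<^sub>L 'a \<Rightarrow>\<^sub>L 'b" where "open V"
    and d1: "\<And>y. y \<in> V \<Longrightarrow> (f has_derivative blinfun_apply (f' y)) (at y)"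
    and d2: "\<And>y. y \<in> V \<Longrightarrow> (f' has_derivative blinfun_apply (f'' y)) (at y)"
    and cont: "continuous_on V f''"
    using assms(1) unfolding C2_on_open_def by blast
  have "isCont f'' x" using cont \<open>open V\<close> assms(2) continuous_on_eq_continuous_at by blast
  then obtain e where "0 < e" and e: "\<And>y. dist y x < e \<Longrightarrow> dist (f'' y) (f'' x) < 1"
    unfolding continuous_at_eps_delta by (metis zero_less_one)
  obtain r where "0 < r" and r: "ball x r \<subseteq> V"
    using \<open>open V\<close> assms(2) open_contains_ball by blast
  define \<delta> where "\<delta> = min e r"
  have sub: "y \<in> V" if "y \<in> ball x \<delta>" for y using that r by (auto simp: \<delta>_def)
  show ?thesis
  proof (rule C11_atI)
    show "0 < \<delta>" using \<open>0 < e\<close> \<open>0 < r\<close> by (simp add: \<delta>_def)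
    show "(f has_derivative blinfun_apply (f' y)) (at y)" if "y \<in> ball x \<delta>" for y
      using d1 sub that by blast
    show "norm (f' z - f' y) \<le> (norm (f'' x) + 1) * norm (z - y)"
      if "y \<in> ball x \<delta>" "z \<in> ball x \<delta>" for y z
    proof (rule differentiable_bound[OF convex_ball[of x \<delta>], where f' = "\<lambda>y. blinfun_apply (f'' y)"])
      fix w assume w: "w \<in> ball x \<delta>"
      show "(f' has_derivative blinfun_apply (f'' w)) (at w within ball x \<delta>)"
        using d2[OF sub[OF w]] has_derivative_at_withinI by blast
      have "norm (f'' w - f'' x) < 1"
        using e[of w] w by (auto simp: \<delta>_def dist_commute dist_norm norm_minus_commute)
      then have "norm (f'' w) \<le> norm (f'' x) + 1"
        using norm_triangle_sub[of "f'' w" "f'' x"] by linarith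
      then show "onorm (blinfun_apply (f'' w)) \<le> norm (f'' x) + 1"
        by (simp add: norm_blinfun.rep_eq)
    qed (use that in auto)
  qed
qed

lemma C11_at_compose:
  fixes f :: "'a::real_normed_vector \<Rightarrow> 'b::real_normed_vector"
    and g :: "'b \<Rightarrow> 'c::real_normed_vector"
  assumes "C11_at f x" and "C11_at g (f x)"
  shows "C11_at (g \<circ> f) x"
proof -
  obtain \<delta> K and f' :: "'a \<Rightarrow> 'a \<Rightarrow>\<^sub>L 'b" where f: "0 < \<delta>" "0 \<le> K"
    "\<And>y. y \<in> ball x \<delta> \<Longrightarrow> (f has_derivative blinfun_apply (f' y)) (at y)"
    "\<And>y z. y \<in> ball x \<delta> \<Longrightarrow> z \<in> ball x \<delta> \<Longrightarrow> norm (f' z - f' y) \<le> K * norm (z - y)"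
    "\<And>y. y \<in> ball x \<delta> \<Longrightarrow> norm (f' y) \<le> K"
    "\<And>y z. y \<in> ball x \<delta> \<Longrightarrow> z \<in> ball x \<delta> \<Longrightarrow> norm (f z - f y) \<le> K * norm (z - y)"
    using C11_atE[OF assms(1)] by metis
  obtain \<epsilon> L and g' :: "'b \<Rightarrow> 'b \<Rightarrow>\<^sub>L 'c" where g: "0 < \<epsilon>" "0 \<le> L"
    "\<And>y. y \<in> ball (f x) \<epsilon> \<Longrightarrow> (g has_derivative blinfun_apply (g' y)) (at y)"
    "\<And>y z. y \<in> ball (f x) \<epsilon> \<Longrightarrow> z \<in> ball (f x) \<epsilon> \<Longrightarrow> norm (g' z - g' y) \<le> L * norm (z - y)"
    "\<And>y. y \<in> ball (f x) \<epsilon> \<Longrightarrow> norm (g' y) \<le> L"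
    using C11_atE[OF assms(2)] by metis
  define \<rho> where "\<rho> = min \<delta> (\<epsilon> / (K + 1))"
  have sub: "y \<in> ball x \<delta>" if "y \<in> ball x \<rho>" for y using that by (simp add: \<rho>_def)
  have im: "f y \<in> ball (f x) \<epsilon>" if y: "y \<in> ball x \<rho>" for y
  proof -
    have "norm (f y - f x) \<le> K * norm (y - x)" using f(6)[of x y] sub[OF y] f(1) by simp
    also have "\<dots> \<le> (K + 1) * norm (y - x)" by (intro mult_right_mono) auto
    also have "\<dots> < \<epsilon>"
      using y f(2) by (simp add: \<rho>_def dist_norm norm_minus_commute pos_less_divide_eq mult.commute)
    finally show ?thesis by (simp add: dist_norm norm_minus_commute)
  qed
  show ?thesis
  proof (rule C11_atI)
    show "0 < \<rho>" using f(1,2) g(1) by (simp add: \<rho>_def)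
    show "((g \<circ> f) has_derivative blinfun_apply (g' (f y) o\<^sub>L f' y)) (at y)"
      if y: "y \<in> ball x \<rho>" for y
      using diff_chain_at[OF f(3)[OF sub[OF y]] g(3)[OF im[OF y]]]
      by (rule has_derivative_eq_rhs) auto
    show "norm ((g' (f z) o\<^sub>L f' z) - (g' (f y) o\<^sub>L f' y)) \<le> (L * K * K + L * K) * norm (z - y)"
      if y: "y \<in> ball x \<rho>" and z: "z \<in> ball x \<rho>" for y z
    proof -
      have "(g' (f z) o\<^sub>L f' z) - (g' (f y) o\<^sub>L f' y)
          = ((g' (f z) - g' (f y)) o\<^sub>L f' z) + (g' (f y) o\<^sub>L (f' z - f' y))"
        by (intro blinfun_eqI) (simp add: blinfun.add_left blinfun.diff_left blinfun.diff_right)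
      also have "norm \<dots> \<le> norm (g' (f z) - g' (f y)) * norm (f' z)
          + norm (g' (f y)) * norm (f' z - f' y)"
        by (intro order_trans[OF norm_triangle_ineq] add_mono norm_blinfun_compose)
      also have "\<dots> \<le> (L * (K * norm (z - y))) * K + L * (K * norm (z - y))"
      proof (intro add_mono mult_mono)
        show "norm (g' (f z) - g' (f y)) \<le> L * (K * norm (z - y))"
          using g(4)[OF im[OF y] im[OF z]] f(6)[OF sub[OF y] sub[OF z]] g(2)
          by (meson mult_left_mono order_trans)
      qed (use f g sub im y z in auto)
      finally show ?thesis by (simp add: algebra_simps)
    qed
  qed
qed

lemma C11_at_linear:
  fixes f :: "'a::real_normed_vector \<Rightarrow> 'b::real_normed_vector"
  assumes "bounded_linear f"
  shows "C11_at f x"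
  by (rule C11_atI[where \<delta> = 1 and f' = "\<lambda>_. Blinfun f" and K = 0])
     (use assms in \<open>auto simp: bounded_linear_Blinfun_apply bounded_linear_imp_has_derivative\<close>)

text \<open>
  The mean value inequality on the segment from \<open>y\<close> to \<open>z\<close>, applied to the function minus its
  linearization at \<open>y\<close>. The base point \<open>y\<close> varies in the ball with one constant \<open>K\<close>: the
  linearization will be taken at points of a manifold tending to \<open>x\<close>.
\<close>

lemma C11_at_quadratic_bound:
  fixes f :: "'a::real_normed_vector \<Rightarrow> 'b::real_normed_vector"
  assumes "C11_at f x"
  obtains \<delta> K where "0 < \<delta>" "0 \<le> K" "\<And>y. y \<in> ball x \<delta> \<Longrightarrow> C11_at f y"
    "\<And>y z. y \<in> ball x \<delta> \<Longrightarrow> z \<in> ball x \<delta> \<Longrightarrow>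
       norm (f z - f y - deriv1 f y (z - y)) \<le> K * (norm (z - y))\<^sup>2"
proof -
  obtain \<delta> K and f' :: "'a \<Rightarrow> 'a \<Rightarrow>\<^sub>L 'b" where f: "0 < \<delta>" "0 \<le> K"
    "\<And>y. y \<in> ball x \<delta> \<Longrightarrow> (f has_derivative blinfun_apply (f' y)) (at y)"
    "\<And>y z. y \<in> ball x \<delta> \<Longrightarrow> z \<in> ball x \<delta> \<Longrightarrow> norm (f' z - f' y) \<le> K * norm (z - y)"
    using C11_atE[OF assms] by metis
  have "C11_at f y" if "y \<in> ball x \<delta>" for y
  proof (rule C11_atI[where \<delta> = "\<delta> - dist x y" and f' = f' and K = K])
    have "w \<in> ball x \<delta>" if "w \<in> ball y (\<delta> - dist x y)" for w
      using that dist_triangle[of x w y] by (simp add: dist_commute)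
    then show "\<And>w. w \<in> ball y (\<delta> - dist x y) \<Longrightarrow> (f has_derivative blinfun_apply (f' w)) (at w)"
      "\<And>w z. w \<in> ball y (\<delta> - dist x y) \<Longrightarrow> z \<in> ball y (\<delta> - dist x y) \<Longrightarrow>
        norm (f' z - f' w) \<le> K * norm (z - w)"
      using f by blast+
  qed (use that in auto)
  moreover have "norm (f z - f y - deriv1 f y (z - y)) \<le> K * (norm (z - y))\<^sup>2"
    if y: "y \<in> ball x \<delta>" and z: "z \<in> ball x \<delta>" for y z
  proof -
    have eq: "deriv1 f y = blinfun_apply (f' y)"
      using f(3)[OF y] frechet_derivative_at by metis
    have seg: "closed_segment y z \<subseteq> ball x \<delta>"
      using y z convex_ball by (metis closed_segment_subset)
    have "norm ((f z - blinfun_apply (f' y) z) - (f y - blinfun_apply (f' y) y))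
        \<le> (K * norm (z - y)) * norm (z - y)"
    proof (rule differentiable_bound[OF convex_closed_segment[of y z],
          where f' = "\<lambda>w. blinfun_apply (f' w - f' y)"])
      fix w assume w: "w \<in> closed_segment y z"
      then have wb: "w \<in> ball x \<delta>" using seg by blast
      show "((\<lambda>w. f w - blinfun_apply (f' y) w) has_derivative blinfun_apply (f' w - f' y))
          (at w within closed_segment y z)"
        unfolding blinfun.diff_left
        by (intro has_derivative_diff has_derivative_at_withinI[OF f(3)[OF wb]]
            bounded_linear_imp_has_derivative blinfun.bounded_linear_right)
      have "norm (f' w - f' y) \<le> K * norm (w - y)" using f(4)[OF y wb] .
      also have "\<dots> \<le> K * norm (z - y)"
        using w f(2) by (intro mult_left_mono) (auto dest: segment_bound1)
      finally show "onorm (blinfun_apply (f' w - f' y)) \<le> K * norm (z - y)"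
        by (simp add: norm_blinfun.rep_eq)
    qed auto
    then show ?thesis by (simp add: eq blinfun.diff_right power2_eq_square algebra_simps)
  qed
  ultimately show thesis using that f(1,2) by blast
qed

lemma has_derivative_gradient:
  fixes h :: "'a::euclidean_space \<Rightarrow> real"
  assumes "h differentiable at x"
  shows "(h has_derivative (\<lambda>d. gradient h x \<bullet> d)) (at x)"
proof -
  have D: "(h has_derivative deriv1 h x) (at x)"
    using assms by (simp add: frechet_derivative_works)
  then have lin: "linear (deriv1 h x)" by (rule has_derivative_linear)
  define p where "p = (\<Sum>b\<in>Basis. deriv1 h x b *\<^sub>R b)"
  have "deriv1 h x d = p \<bullet> d" for d
  proof -
    have "deriv1 h x d = deriv1 h x (\<Sum>b\<in>Basis. (d \<bullet> b) *\<^sub>R b)" by (simp add: euclidean_representation)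
    also have "\<dots> = p \<bullet> d"
      by (simp add: p_def linear_sum[OF lin] linear_scale[OF lin] inner_sum_left inner_sum_right
          inner_commute mult.commute)
    finally show ?thesis .
  qed
  then have p: "GDERIV h x :> p"
    unfolding gderiv_def by (intro has_derivative_eq_rhs[OF D]) (auto simp: inner_commute)
  have "gradient h x = p"
    unfolding gradient_def using p
  proof (rule the_equality)
    fix d assume "GDERIV h x :> d"
    then have "(\<lambda>u. u \<bullet> d) = (\<lambda>u. u \<bullet> p)"
      using p unfolding gderiv_def by (rule has_derivative_unique)
    then have "(d - p) \<bullet> d = (d - p) \<bullet> p" by meson
    then have "(d - p) \<bullet> (d - p) = 0" by (simp add: inner_diff_right)
    then show "d = p" by simp
  qed
  then show ?thesis using p by (simp add: gderiv_def inner_commute)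
qed

lemma gradient_eqI:
  fixes h :: "'a::euclidean_space \<Rightarrow> real"
  assumes "(h has_derivative (\<lambda>d. p \<bullet> d)) (at x)"
  shows "gradient h x = p"
proof -
  have "(\<lambda>u. gradient h x \<bullet> u) = (\<lambda>u. p \<bullet> u)"
    using has_derivative_unique[OF has_derivative_gradient assms] assms
    unfolding differentiable_def by blast
  then show ?thesis by (metis vector_eq_rdot)
qed

lemma C11_at_differentiable: "C11_at f x \<Longrightarrow> f differentiable at x"
  by (metis C11_atE centre_in_ball differentiable_def)

lemma C11_at_isCont: "C11_at f x \<Longrightarrow> isCont f x"
  by (simp add: C11_at_differentiable differentiable_imp_continuous_within)

text \<open>
  Testing the difference of two gradients against itself bounds its norm by the norm of the
  difference of the derivatives.
\<close>

lemma C11_at_isCont_gradient: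
  fixes h :: "'a::euclidean_space \<Rightarrow> real"
  assumes "C11_at h x"
  shows "isCont (gradient h) x"
proof -
  obtain \<delta> K and h' :: "'a \<Rightarrow> 'a \<Rightarrow>\<^sub>L real" where h: "0 < \<delta>" "0 \<le> K"
    "\<And>y. y \<in> ball x \<delta> \<Longrightarrow> (h has_derivative blinfun_apply (h' y)) (at y)"
    "\<And>y z. y \<in> ball x \<delta> \<Longrightarrow> z \<in> ball x \<delta> \<Longrightarrow> norm (h' z - h' y) \<le> K * norm (z - y)"
    using C11_atE[OF assms] by metis
  have "norm (gradient h y - gradient h x) \<le> K * norm (y - x)" if y: "y \<in> ball x \<delta>" for y
  proof -
    have *: "blinfun_apply (h' w) d = gradient h w \<bullet> d" if "w \<in> ball x \<delta>" for w d
      using has_derivative_unique[OF h(3)[OF that] has_derivative_gradient] h(3)[OF that]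
      unfolding differentiable_def by metis
    let ?d = "gradient h y - gradient h x"
    have "norm ?d * norm ?d = blinfun_apply (h' y - h' x) ?d"
      using * y h(1) by (simp add: blinfun.diff_left inner_diff_left flip: power2_norm_eq_inner power2_eq_square)
         (simp add: power2_norm_eq_inner inner_diff_left)
    also have "\<dots> \<le> norm (h' y - h' x) * norm ?d" using norm_blinfun[of "h' y - h' x" ?d] by simp
    also have "\<dots> \<le> (K * norm (y - x)) * norm ?d" using h(1,4) y by (intro mult_right_mono) auto
    finally show ?thesis
      by (cases "?d = 0") (use h(2) in auto)
  qed
  then have "\<forall>\<^sub>F y in at x. norm (gradient h y - gradient h x) \<le> K * norm (y - x)"
    using h(1) by (auto simp: eventually_at dist_commute)
  moreover have "((\<lambda>y. K * norm (y - x)) \<longlongrightarrow> 0) (at x)"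
    by (auto intro!: tendsto_eq_intros)
  ultimately have "((\<lambda>y. gradient h y - gradient h x) \<longlongrightarrow> 0) (at x)"
    by (rule Lim_null_comparison)
  then show ?thesis unfolding isCont_def using LIM_zero_iff by blast
qed

section \<open>The subdifferential of a finite maximum\<close>

lemma max_fun_ge: "h i x \<le> max_fun h x"
  by (simp add: max_fun_def)

lemma active_set_nonempty: "active_set h x \<noteq> {}"
proof -
  have "max_fun h x \<in> range (\<lambda>i. h i x)" unfolding max_fun_def by (intro Max_in) auto
  then show ?thesis by (auto simp: active_set_def)
qed

lemma max_fun_less_iff: "max_fun h x < c \<longleftrightarrow> (\<forall>i. h i x < c)"
  by (simp add: max_fun_def)

lemma isCont_max_fun:
  fixes h :: "'i::finite \<Rightarrow> 'a::t2_space \<Rightarrow> real"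
  assumes "\<And>i. isCont (h i) x"
  shows "isCont (max_fun h) x"
  unfolding isCont_def order_tendsto_iff
proof (intro conjI allI impI)
  fix c assume c: "c < max_fun h x"
  obtain i where "h i x = max_fun h x" using active_set_nonempty[of h x] by (auto simp: active_set_def)
  with c assms[of i] have "\<forall>\<^sub>F y in at x. c < h i y"
    unfolding isCont_def order_tendsto_iff by simp
  then show "\<forall>\<^sub>F y in at x. c < max_fun h y"
    by eventually_elim (rule less_le_trans[OF _ max_fun_ge])
next
  fix c assume "max_fun h x < c"
  then have "\<forall>\<^sub>F y in at x. h i y < c" for i
    using assms[of i] unfolding isCont_def order_tendsto_iff max_fun_less_iff by blast
  then show "\<forall>\<^sub>F y in at x. max_fun h y < c"
    unfolding max_fun_less_iff by (rule eventually_all_finite)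
qed

lemma eventually_active_set_subset:
  fixes h :: "'i::finite \<Rightarrow> 'a::t2_space \<Rightarrow> real"
  assumes "\<And>i. isCont (h i) x"
  shows "\<forall>\<^sub>F y in nhds x. active_set h y \<subseteq> active_set h x"
proof -
  have "\<forall>\<^sub>F y in nhds x. i \<notin> active_set h x \<longrightarrow> i \<notin> active_set h y" for i
  proof (cases "i \<in> active_set h x")
    case False
    then have "h i x - max_fun h x < 0" using max_fun_ge[of h i x] by (simp add: active_set_def)
    moreover have "((\<lambda>y. h i y - max_fun h y) \<longlongrightarrow> h i x - max_fun h x) (nhds x)"
      using assms[of i] isCont_max_fun[OF assms]
      by (intro tendsto_diff) (auto simp: tendsto_nhds_iff isCont_def)
    ultimately have "\<forall>\<^sub>F y in nhds x. h i y - max_fun h y < 0"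
      unfolding order_tendsto_iff by blast
    then show ?thesis by eventually_elim (auto simp: active_set_def)
  qed simp
  then have "\<forall>\<^sub>F y in nhds x. \<forall>i. i \<notin> active_set h x \<longrightarrow> i \<notin> active_set h y"
    by (rule eventually_all_finite)
  then show ?thesis by eventually_elim auto
qed

text \<open>
  The convex hull of the active gradients, with the multipliers kept visible: identification
  depends on their supports.
\<close>

definition active_gradient_hull ::
    "('i::finite \<Rightarrow> 'a::euclidean_space \<Rightarrow> real) \<Rightarrow> 'a \<Rightarrow> 'a set" where
  "active_gradient_hull h x =
     {\<Sum>i\<in>UNIV. l i *\<^sub>R gradient (h i) x | l. l \<in> std_simplex \<and> supp l \<subseteq> active_set h x}"

lemma active_gradient_hullI:
  assumes "l \<in> std_simplex" and "supp l \<subseteq> active_set h x"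
    and "v = (\<Sum>i\<in>UNIV. l i *\<^sub>R gradient (h i) x)"
  shows "v \<in> active_gradient_hull h x"
  unfolding active_gradient_hull_def using assms by blast

text \<open>
  Compactness of the simplex. The two inclusions for the support of the limit are what
  identification rests on: it is active at \<open>x\<close> because inactive pieces stay inactive nearby, and
  it is contained in the supports along the subsequence because a positive limit forces positive
  terms.
\<close>

lemma multipliers_limit:
  fixes h :: "'i::finite \<Rightarrow> 'a::euclidean_space \<Rightarrow> real"
  assumes h: "\<And>i. C11_at (h i) x" and xs: "xs \<longlonglongrightarrow> x"
    and l: "\<And>\<nu>. l \<nu> \<in> std_simplex" "\<And>\<nu>. supp (l \<nu>) \<subseteq> active_set h (xs \<nu>)"
  obtains l' r where "strict_mono r" "l' \<in> std_simplex" "supp l' \<subseteq> active_set h x"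
    "(\<lambda>\<nu>. \<Sum>i\<in>UNIV. l (r \<nu>) i *\<^sub>R gradient (h i) (xs (r \<nu>)))
       \<longlonglongrightarrow> (\<Sum>i\<in>UNIV. l' i *\<^sub>R gradient (h i) x)"
    "\<forall>\<^sub>F \<nu> in sequentially. supp l' \<subseteq> supp (l (r \<nu>))"
proof -
  have l1: "l \<nu> i \<le> 1" for \<nu> i
    using member_le_sum[of i UNIV "l \<nu>"] l(1)[of \<nu>] by (auto simp: std_simplex_def)
  have "(\<chi> i. l \<nu> i) \<in> cbox 0 1" for \<nu>
    using l1 l(1)[of \<nu>] by (auto simp: mem_box_cart std_simplex_def)
  then obtain L r where r: "strict_mono r" and L: "((\<lambda>\<nu>. (\<chi> i. l \<nu> i)) \<circ> r) \<longlonglongrightarrow> L"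
    using compact_imp_seq_compact[OF compact_cbox] unfolding seq_compact_def by metis
  define l' where "l' i = L $ i" for i
  have lim: "(\<lambda>\<nu>. l (r \<nu>) i) \<longlonglongrightarrow> l' i" for i
    using tendsto_vec_nth[OF L, of i] by (simp add: l'_def o_def)
  have xr: "(\<lambda>\<nu>. xs (r \<nu>)) \<longlonglongrightarrow> x"
    using LIMSEQ_subseq_LIMSEQ[OF xs r] by (simp add: o_def)
  show thesis
  proof (rule that[OF r])
    have "0 \<le> l' i" for i
      by (rule LIMSEQ_le_const[OF lim]) (use l(1) in \<open>auto simp: std_simplex_def\<close>)
    moreover have "(\<Sum>i\<in>UNIV. l' i) = 1"
    proof (rule LIMSEQ_unique)
      show "(\<lambda>\<nu>. \<Sum>i\<in>UNIV. l (r \<nu>) i) \<longlonglongrightarrow> (\<Sum>i\<in>UNIV. l' i)"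
        by (intro tendsto_sum lim)
      show "(\<lambda>\<nu>. \<Sum>i\<in>UNIV. l (r \<nu>) i) \<longlonglongrightarrow> 1"
        using l(1) by (simp add: std_simplex_def)
    qed
    ultimately show "l' \<in> std_simplex" by (simp add: std_simplex_def)
    have "\<forall>\<^sub>F \<nu> in sequentially. active_set h (xs (r \<nu>)) \<subseteq> active_set h x"
      using eventually_active_set_subset[OF C11_at_isCont[OF h]] xr
      by (rule eventually_compose_filterlim)
    then have ev: "\<forall>\<^sub>F \<nu> in sequentially. supp (l (r \<nu>)) \<subseteq> active_set h x"
      by eventually_elim (use l(2) in blast)
    show "supp l' \<subseteq> active_set h x"
    proof (rule ccontr)
      assume "\<not> supp l' \<subseteq> active_set h x"
      then obtain i where i: "l' i \<noteq> 0" "i \<notin> active_set h x" by (auto simp: supp_def)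
      have "\<forall>\<^sub>F \<nu> in sequentially. l (r \<nu>) i = 0"
        using ev by eventually_elim (use i(2) in \<open>auto simp: supp_def\<close>)
      then have "(\<lambda>\<nu>. l (r \<nu>) i) \<longlonglongrightarrow> 0" by (rule tendsto_eventually)
      then show False using LIMSEQ_unique[OF lim] i(1) by blast
    qed
    show "(\<lambda>\<nu>. \<Sum>i\<in>UNIV. l (r \<nu>) i *\<^sub>R gradient (h i) (xs (r \<nu>)))
       \<longlonglongrightarrow> (\<Sum>i\<in>UNIV. l' i *\<^sub>R gradient (h i) x)"
      by (intro tendsto_sum tendsto_scaleR lim isCont_tendsto_compose[OF C11_at_isCont_gradient[OF h] xr])
    have "\<forall>\<^sub>F \<nu> in sequentially. l' i \<noteq> 0 \<longrightarrow> l (r \<nu>) i \<noteq> 0" for i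
      using tendsto_imp_eventually_ne[OF lim, of i 0] by (cases "l' i = 0") auto
    then have "\<forall>\<^sub>F \<nu> in sequentially. \<forall>i. l' i \<noteq> 0 \<longrightarrow> l (r \<nu>) i \<noteq> 0"
      by (rule eventually_all_finite)
    then show "\<forall>\<^sub>F \<nu> in sequentially. supp l' \<subseteq> supp (l (r \<nu>))"
      by eventually_elim (auto simp: supp_def)
  qed
qed

lemma active_gradient_hull_closed_graph:
  fixes h :: "'i::finite \<Rightarrow> 'a::euclidean_space \<Rightarrow> real"
  assumes h: "\<And>i. C11_at (h i) x" and xs: "xs \<longlonglongrightarrow> x" and vs: "vs \<longlonglongrightarrow> v"
    and mem: "\<And>\<nu>. vs \<nu> \<in> active_gradient_hull h (xs \<nu>)"
  shows "v \<in> active_gradient_hull h x"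
proof -
  obtain l where l: "\<And>\<nu>. l \<nu> \<in> std_simplex" "\<And>\<nu>. supp (l \<nu>) \<subseteq> active_set h (xs \<nu>)"
    "\<And>\<nu>. vs \<nu> = (\<Sum>i\<in>UNIV. l \<nu> i *\<^sub>R gradient (h i) (xs \<nu>))"
    using mem unfolding active_gradient_hull_def mem_Collect_eq by metis
  obtain l' r where r: "strict_mono r" and l': "l' \<in> std_simplex" "supp l' \<subseteq> active_set h x"
    and lim: "(\<lambda>\<nu>. \<Sum>i\<in>UNIV. l (r \<nu>) i *\<^sub>R gradient (h i) (xs (r \<nu>)))
       \<longlonglongrightarrow> (\<Sum>i\<in>UNIV. l' i *\<^sub>R gradient (h i) x)"
    and "\<forall>\<^sub>F \<nu> in sequentially. supp l' \<subseteq> supp (l (r \<nu>))"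
    by (rule multipliers_limit[where h = h and l = l, OF h xs l(1,2)])
  have "(vs \<circ> r) \<longlonglongrightarrow> (\<Sum>i\<in>UNIV. l' i *\<^sub>R gradient (h i) x)"
    using lim by (simp add: l(3) o_def)
  then have "v = (\<Sum>i\<in>UNIV. l' i *\<^sub>R gradient (h i) x)"
    using LIMSEQ_unique LIMSEQ_subseq_LIMSEQ[OF vs r] by blast
  then show ?thesis by (rule active_gradient_hullI[OF l'])
qed

lemma convex_active_gradient_hull: "convex (active_gradient_hull h x)"
proof (rule convexI)
  fix p q and s t :: real
  assume "p \<in> active_gradient_hull h x" "q \<in> active_gradient_hull h x"
    and st: "0 \<le> s" "0 \<le> t" "s + t = 1"
  then obtain k l where k: "k \<in> std_simplex" "supp k \<subseteq> active_set h x"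
      "p = (\<Sum>i\<in>UNIV. k i *\<^sub>R gradient (h i) x)"
    and l: "l \<in> std_simplex" "supp l \<subseteq> active_set h x"
      "q = (\<Sum>i\<in>UNIV. l i *\<^sub>R gradient (h i) x)"
    unfolding active_gradient_hull_def by blast
  let ?m = "\<lambda>i. s * k i + t * l i"
  have "?m \<in> std_simplex" using k(1) l(1) st
    by (auto simp: std_simplex_def sum.distrib simp flip: sum_distrib_left)
  moreover have "supp ?m \<subseteq> active_set h x" using k(2) l(2) by (fastforce simp: supp_def)
  moreover have "s *\<^sub>R p + t *\<^sub>R q = (\<Sum>i\<in>UNIV. ?m i *\<^sub>R gradient (h i) x)"
    by (simp add: k(3) l(3) scaleR_sum_right sum.distrib scaleR_add_left)
  ultimately show "s *\<^sub>R p + t *\<^sub>R q \<in> active_gradient_hull h x"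
    by (rule active_gradient_hullI)
qed

lemma gradient_mem_active_gradient_hull:
  fixes h :: "'i::finite \<Rightarrow> 'a::euclidean_space \<Rightarrow> real"
  assumes "i \<in> active_set h x"
  shows "gradient (h i) x \<in> active_gradient_hull h x"
proof -
  let ?l = "\<lambda>j. if j = i then 1 else 0 :: real"
  have "?l \<in> std_simplex" by (simp add: std_simplex_def)
  moreover have "supp ?l \<subseteq> active_set h x" using assms by (auto simp: supp_def)
  moreover have "gradient (h i) x = (\<Sum>j\<in>UNIV. ?l j *\<^sub>R gradient (h j) x)"
    by (simp add: if_distrib[of "\<lambda>c. c *\<^sub>R _"] cong: if_cong)
  ultimately show ?thesis by (rule active_gradient_hullI)
qed

text \<open>
  If \<open>v\<close> is not in the hull, a hyperplane separates them. Moving from \<open>x\<close> along its normal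
  direction \<open>d\<close>, every active piece increases at a rate below \<open>v \<bullet> d\<close> and the inactive pieces stay
  strictly smaller, so the maximum violates the lower bound that \<open>v\<close> imposes.
\<close>

lemma regular_subdifferential_max_subset:
  fixes h :: "'i::finite \<Rightarrow> 'a::euclidean_space \<Rightarrow> real"
  assumes h: "\<And>i. C11_at (h i) x" and v: "v \<in> regular_subdifferential (max_fun h) x"
  shows "v \<in> active_gradient_hull h x"
proof (rule ccontr)
  let ?f = "max_fun h"
  assume "v \<notin> active_gradient_hull h x"
  moreover have "closed (active_gradient_hull h x)"
    unfolding closed_sequential_limits
    using active_gradient_hull_closed_graph[where h = h, OF h tendsto_const] by blast
  ultimately obtain a b where av: "a \<bullet> v < b"
    and ab: "\<And>p. p \<in> active_gradient_hull h x \<Longrightarrow> b < a \<bullet> p"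
    using separating_hyperplane_closed_point[OF convex_active_gradient_hull] by metis
  define d where "d = - a"
  have ray: "((\<lambda>t. x + t *\<^sub>R d) \<longlongrightarrow> x) (at_right 0)"
    by (auto intro!: tendsto_eq_intros)
  have upper: "\<forall>\<^sub>F t in at_right 0. h i (x + t *\<^sub>R d) < ?f x - t * b" for i
  proof (cases "i \<in> active_set h x")
    case True
    have "((\<lambda>t. h i (x + t *\<^sub>R d)) has_derivative (\<lambda>s. gradient (h i) x \<bullet> (s *\<^sub>R d))) (at 0)"
      by (rule has_derivative_compose[where g = "h i"])
         (auto intro!: derivative_eq_intros has_derivative_gradient C11_at_differentiable h)
    then have "((\<lambda>t. h i (x + t *\<^sub>R d)) has_real_derivative (gradient (h i) x \<bullet> d)) (at 0)"
      unfolding has_field_derivative_def by (rule has_derivative_eq_rhs) (auto simp: mult.commute)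
    then have "((\<lambda>t. (h i (x + t *\<^sub>R d) - h i x) / t) \<longlongrightarrow> gradient (h i) x \<bullet> d) (at_right 0)"
      unfolding has_field_derivative_iff by (auto intro: filterlim_mono[OF _ order_refl at_le])
    moreover have "gradient (h i) x \<bullet> d < - b"
      using ab[OF gradient_mem_active_gradient_hull[OF True]] by (simp add: d_def inner_commute)
    ultimately have "\<forall>\<^sub>F t in at_right 0. (h i (x + t *\<^sub>R d) - h i x) / t < - b"
      unfolding order_tendsto_iff by blast
    then show ?thesis using eventually_at_right_less[of 0]
      by eventually_elim (use True in \<open>auto simp: active_set_def field_simps\<close>)
  next
    case False
    then have "h i x < ?f x" using max_fun_ge[of h i x] by (simp add: active_set_def)
    moreover have "((\<lambda>t. h i (x + t *\<^sub>R d) + t * b) \<longlongrightarrow> h i x + 0 * b) (at_right 0)"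
      by (intro tendsto_intros isCont_tendsto_compose[OF C11_at_isCont[OF h] ray])
    ultimately have "\<forall>\<^sub>F t in at_right 0. h i (x + t *\<^sub>R d) + t * b < ?f x"
      unfolding order_tendsto_iff by simp
    then show ?thesis by eventually_elim simp
  qed
  (* Small enough that \<epsilon> |d| does not exceed the gap in the separation. *)
  define \<epsilon> where "\<epsilon> = (b - a \<bullet> v) / (norm d + 1)"
  have "0 < \<epsilon>" using av by (simp add: \<epsilon>_def add_nonneg_pos)
  have "\<forall>\<^sub>F y in nhds x. ?f y \<ge> ?f x + v \<bullet> (y - x) - \<epsilon> * norm (y - x)"
    using v \<open>0 < \<epsilon>\<close> unfolding regular_subdifferential_def eventually_nhds_conv_at by auto
  then have lower: "\<forall>\<^sub>F t in at_right 0. ?f (x + t *\<^sub>R d) \<ge> ?f x + v \<bullet> (t *\<^sub>R d) - \<epsilon> * norm (t *\<^sub>R d)"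
    using eventually_compose_filterlim[OF _ ray] by fastforce
  have "\<forall>\<^sub>F t in at_right 0. \<forall>i. h i (x + t *\<^sub>R d) < ?f x - t * b"
    using upper by (rule eventually_all_finite)
  then have "\<forall>\<^sub>F t :: real in at_right 0. False"
    using lower eventually_at_right_less[of 0]
  proof eventually_elim
    case (elim t)
    have "?f (x + t *\<^sub>R d) < ?f x - t * b" using elim(1) by (simp add: max_fun_less_iff)
    then have "t * (v \<bullet> d - \<epsilon> * norm d) < t * (- b)"
      using elim(2,3) by (simp add: algebra_simps)
    then have "v \<bullet> d - \<epsilon> * norm d < - b" using elim(3) mult_less_cancel_left_pos by blast
    moreover have "\<epsilon> * norm d \<le> b - a \<bullet> v"
      using av by (simp add: \<epsilon>_def pos_divide_le_eq add_nonneg_pos)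
    ultimately show False by (simp add: d_def inner_commute)
  qed
  then show False by simp
qed

lemma regular_subdifferential_subset_limiting:
  "regular_subdifferential f x \<subseteq> limiting_subdifferential f x"
proof
  fix v assume "v \<in> regular_subdifferential f x"
  then show "v \<in> limiting_subdifferential f x"
    unfolding limiting_subdifferential_def mem_Collect_eq
    by - (rule exI[of _ "\<lambda>_. x"], rule exI[of _ "\<lambda>_. v"], simp)
qed

lemma limiting_subdifferential_max_subset:
  fixes h :: "'i::finite \<Rightarrow> 'a::euclidean_space \<Rightarrow> real"
  assumes "\<And>i y. C11_at (h i) y"
  shows "limiting_subdifferential (max_fun h) x \<subseteq> active_gradient_hull h x"
proof
  fix v assume "v \<in> limiting_subdifferential (max_fun h) x"
  then obtain xs vs where lim: "xs \<longlonglongrightarrow> x" "vs \<longlonglongrightarrow> v"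
    and reg: "\<And>\<nu>. vs \<nu> \<in> regular_subdifferential (max_fun h) (xs \<nu>)"
    unfolding limiting_subdifferential_def mem_Collect_eq by metis
  show "v \<in> active_gradient_hull h x"
    by (rule active_gradient_hull_closed_graph[where h = h, OF assms lim])
       (rule regular_subdifferential_max_subset[where h = h, OF assms reg])
qed

lemma regular_subdifferentialI_quadratic:
  assumes "\<forall>\<^sub>F y in nhds x. f y \<ge> f x + v \<bullet> (y - x) - K * (norm (y - x))\<^sup>2"
  shows "v \<in> regular_subdifferential f x"
  unfolding regular_subdifferential_def
proof (intro CollectI allI impI)
  fix \<epsilon> :: real assume "0 < \<epsilon>"
  have "((\<lambda>y. K * norm (y - x)) \<longlongrightarrow> K * norm (x - x)) (nhds x)"
    by (intro tendsto_intros filterlim_ident)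
  then have "\<forall>\<^sub>F y in nhds x. K * norm (y - x) < \<epsilon>"
    using \<open>0 < \<epsilon>\<close> unfolding order_tendsto_iff by simp
  with assms have "\<forall>\<^sub>F y in nhds x. f y \<ge> f x + v \<bullet> (y - x) - \<epsilon> * norm (y - x)"
  proof eventually_elim
    case (elim y)
    have "K * (norm (y - x))\<^sup>2 \<le> \<epsilon> * norm (y - x)"
      using elim(2) by (simp add: power2_eq_square mult_right_mono flip: mult.assoc)
    with elim(1) show ?case by linarith
  qed
  then show "\<forall>\<^sub>F y in at x. f y \<ge> f x + v \<bullet> (y - x) - \<epsilon> * norm (y - x)"
    unfolding eventually_nhds_conv_at by blast
qed

text \<open>
  The maximum dominates every convex combination of the pieces. Taking the combination that
  represents \<open>v\<close>, the quadratic bounds for the pieces add up.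
\<close>

lemma max_fun_quadratic_minorant:
  fixes h :: "'i::finite \<Rightarrow> 'a::euclidean_space \<Rightarrow> real"
  assumes h: "\<And>i. C11_at (h i) x" and v: "v \<in> active_gradient_hull h x"
  obtains K where "\<forall>\<^sub>F y in nhds x. max_fun h y \<ge> max_fun h x + v \<bullet> (y - x) - K * (norm (y - x))\<^sup>2"
proof -
  have "\<exists>K. \<forall>\<^sub>F y in nhds x. h i y \<ge> h i x + gradient (h i) x \<bullet> (y - x) - K * (norm (y - x))\<^sup>2" for i
  proof -
    obtain \<delta> K where "0 < \<delta>"
      and K: "\<And>y. y \<in> ball x \<delta> \<Longrightarrow> norm (h i y - h i x - deriv1 (h i) x (y - x)) \<le> K * (norm (y - x))\<^sup>2"
      using C11_at_quadratic_bound[OF h] centre_in_ball by metis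
    have "deriv1 (h i) x = (\<lambda>d. gradient (h i) x \<bullet> d)"
      using frechet_derivative_at[OF has_derivative_gradient[OF C11_at_differentiable[OF h]]] by simp
    then have "h i y \<ge> h i x + gradient (h i) x \<bullet> (y - x) - K * (norm (y - x))\<^sup>2"
      if "y \<in> ball x \<delta>" for y
      using K[OF that] by (auto simp: abs_le_iff)
    then show ?thesis
      using \<open>0 < \<delta>\<close> unfolding eventually_nhds_metric by (intro exI[of _ K] exI[of _ \<delta>]) (auto simp: dist_commute)
  qed
  then obtain K where "\<And>i. \<forall>\<^sub>F y in nhds x. h i y \<ge> h i x + gradient (h i) x \<bullet> (y - x) - K i * (norm (y - x))\<^sup>2"
    by metis
  then have all: "\<forall>\<^sub>F y in nhds x. \<forall>i. h i y \<ge> h i x + gradient (h i) x \<bullet> (y - x) - K i * (norm (y - x))\<^sup>2"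
    by (rule eventually_all_finite)
  obtain l where l: "l \<in> std_simplex" "supp l \<subseteq> active_set h x"
      "v = (\<Sum>i\<in>UNIV. l i *\<^sub>R gradient (h i) x)"
    using v unfolding active_gradient_hull_def by blast
  have l0: "0 \<le> l i" and l1: "(\<Sum>i\<in>UNIV. l i) = 1" for i using l(1) by (auto simp: std_simplex_def)
  show thesis
  proof (rule that[of "\<Sum>i\<in>UNIV. l i * K i"], use all in eventually_elim)
    case (elim y)
    have "l i * h i x = l i * max_fun h x" for i
      using l(2) by (cases "l i = 0") (auto simp: supp_def active_set_def)
    then have "(\<Sum>i\<in>UNIV. l i * h i x) = (\<Sum>i\<in>UNIV. l i * max_fun h x)" by (rule sum.cong[OF refl])
    then have "(\<Sum>i\<in>UNIV. l i * (h i x + gradient (h i) x \<bullet> (y - x) - K i * (norm (y - x))\<^sup>2))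
        = (\<Sum>i\<in>UNIV. l i * max_fun h x) + (\<Sum>i\<in>UNIV. l i * (gradient (h i) x \<bullet> (y - x)))
          - (\<Sum>i\<in>UNIV. l i * K i * (norm (y - x))\<^sup>2)"
      by (simp only: distrib_left right_diff_distrib sum.distrib sum_subtractf mult.assoc)
    also have "(\<Sum>i\<in>UNIV. l i * max_fun h x) = max_fun h x"
      by (simp only: l1 sum_distrib_right[symmetric] mult_1)
    also have "(\<Sum>i\<in>UNIV. l i * (gradient (h i) x \<bullet> (y - x))) = v \<bullet> (y - x)"
      by (simp add: l(3) inner_sum_left)
    also have "(\<Sum>i\<in>UNIV. l i * K i * (norm (y - x))\<^sup>2) = (\<Sum>i\<in>UNIV. l i * K i) * (norm (y - x))\<^sup>2"
      by (rule sum_distrib_right[symmetric])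
    finally have "max_fun h x + v \<bullet> (y - x) - (\<Sum>i\<in>UNIV. l i * K i) * (norm (y - x))\<^sup>2
        = (\<Sum>i\<in>UNIV. l i * (h i x + gradient (h i) x \<bullet> (y - x) - K i * (norm (y - x))\<^sup>2))" ..
    also have "\<dots> \<le> (\<Sum>i\<in>UNIV. l i * max_fun h y)"
      by (intro sum_mono mult_left_mono order_trans[OF spec[OF elim] max_fun_ge[of h]] l0)
    also have "\<dots> = max_fun h y" by (simp only: l1 sum_distrib_right[symmetric] mult_1)
    finally show ?case by simp
  qed
qed

lemma active_gradient_hull_subset_regular:
  fixes h :: "'i::finite \<Rightarrow> 'a::euclidean_space \<Rightarrow> real"
  assumes "\<And>i. C11_at (h i) x"
  shows "active_gradient_hull h x \<subseteq> regular_subdifferential (max_fun h) x"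
proof
  fix v assume "v \<in> active_gradient_hull h x"
  then obtain K where "\<forall>\<^sub>F y in nhds x. max_fun h y \<ge> max_fun h x + v \<bullet> (y - x) - K * (norm (y - x))\<^sup>2"
    by (rule max_fun_quadratic_minorant[where h = h, OF assms])
  then show "v \<in> regular_subdifferential (max_fun h) x"
    by (rule regular_subdifferentialI_quadratic)
qed

section \<open>The minimal identifiable set of a finite maximum\<close>

text \<open>
  The sequential definition of identifiability as a statement about neighbourhoods: all
  points close to \<open>x\<close> with a subgradient close to \<open>v\<close> lie in \<open>N\<close>. Otherwise points violating it at
  scale \<open>1/n\<close> form a forbidden sequence.
\<close>

lemma identifiable_uniform:
  assumes "identifiable f x v N"
  obtains e where "0 < e"
    "\<And>y u. dist y x < e \<Longrightarrow> dist u v < e \<Longrightarrow> u \<in> limiting_subdifferential f y \<Longrightarrow> y \<in> N"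
proof -
  have "\<exists>e>0. \<forall>y u. dist y x < e \<and> dist u v < e \<and> u \<in> limiting_subdifferential f y \<longrightarrow> y \<in> N"
  proof (rule ccontr)
    assume "\<not> ?thesis"
    then have neg: "\<exists>y u. dist y x < e \<and> dist u v < e \<and> u \<in> limiting_subdifferential f y \<and> y \<notin> N"
      if "0 < e" for e :: real
      using that by blast
    have "\<forall>n::nat. \<exists>y u. dist y x < inverse (Suc n) \<and> dist u v < inverse (Suc n)
        \<and> u \<in> limiting_subdifferential f y \<and> y \<notin> N"
      by (intro allI neg) simp
    then obtain xs vs where seq: "\<And>n. dist (xs n) x < inverse (Suc n)" "\<And>n. dist (vs n) v < inverse (Suc n)"
        "\<And>n. vs n \<in> limiting_subdifferential f (xs n)" "\<And>n. xs n \<notin> N"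
      by metis
    have "xs \<longlonglongrightarrow> x" "vs \<longlonglongrightarrow> v"
      using seq(1,2) by (auto intro!: metric_tendsto_imp_tendsto[OF LIMSEQ_inverse_real_of_nat]
        always_eventually less_imp_le)
    then have "\<forall>\<^sub>F n in sequentially. xs n \<in> N"
      using assms seq(3) unfolding identifiable_def by blast
    then show False using seq(4) by (simp add: eventually_False)
  qed
  then show thesis using that by blast
qed

definition critical_multipliers ::
    "('i::finite \<Rightarrow> 'a::euclidean_space \<Rightarrow> real) \<Rightarrow> 'a \<Rightarrow> ('i \<Rightarrow> real) set" where
  "critical_multipliers h x = {l \<in> std_simplex. supp l \<subseteq> active_set h x \<and>
     (\<Sum>i\<in>UNIV. l i *\<^sub>R gradient (h i) x) = 0}"

text \<open>
  For \<open>h i = g i \<circ> F\<close> this is the minimal identifiable set of the composite function, see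
  \<open>minimal_identifiable_set_eq_critical_region\<close>.
\<close>

definition critical_region ::
    "('i::finite \<Rightarrow> 'a::euclidean_space \<Rightarrow> real) \<Rightarrow> 'a \<Rightarrow> 'a set" where
  "critical_region h x = {y. \<exists>l\<in>critical_multipliers h x. supp l \<subseteq> active_set h y}"

text \<open>
  Were it false, a subsequence would avoid the region while its subgradients tend to \<open>0\<close>. A limit
  of their multipliers is a critical multiplier whose support is active along the sequence, which
  puts the points into the region.
\<close>

lemma identifiable_critical_region:
  fixes h :: "'i::finite \<Rightarrow> 'a::euclidean_space \<Rightarrow> real"
  assumes h: "\<And>i y. C11_at (h i) y" and crit: "0 \<in> limiting_subdifferential (max_fun h) x"
  shows "identifiable (max_fun h) x 0 (critical_region h x)"
  unfolding identifiable_def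
proof (intro conjI allI impI crit)
  have "0 \<in> active_gradient_hull h x"
    using crit limiting_subdifferential_max_subset[where h = h, OF h] by blast
  then show "x \<in> critical_region h x"
    unfolding active_gradient_hull_def critical_region_def critical_multipliers_def by fastforce
next
  fix xs vs
  assume xs: "xs \<longlonglongrightarrow> x" and vs: "vs \<longlonglongrightarrow> 0"
    and sub: "\<forall>\<nu>. vs \<nu> \<in> limiting_subdifferential (max_fun h) (xs \<nu>)"
  show "\<forall>\<^sub>F \<nu> in sequentially. xs \<nu> \<in> critical_region h x"
  proof (rule ccontr)
    assume "\<not> ?thesis"
    then obtain s :: "nat \<Rightarrow> nat" where s: "strict_mono s" "\<And>n. xs (s n) \<notin> critical_region h x"
      using not_eventually_sequentiallyD by metis
    have xss: "(\<lambda>n. xs (s n)) \<longlonglongrightarrow> x" and vss: "(\<lambda>n. vs (s n)) \<longlonglongrightarrow> 0"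
      using LIMSEQ_subseq_LIMSEQ[OF xs s(1)] LIMSEQ_subseq_LIMSEQ[OF vs s(1)] by (simp_all add: o_def)
    have "vs (s n) \<in> active_gradient_hull h (xs (s n))" for n
      using sub limiting_subdifferential_max_subset[where h = h, OF h] by blast
    then obtain l where l: "\<And>n. l n \<in> std_simplex" "\<And>n. supp (l n) \<subseteq> active_set h (xs (s n))"
      "\<And>n. vs (s n) = (\<Sum>i\<in>UNIV. l n i *\<^sub>R gradient (h i) (xs (s n)))"
      unfolding active_gradient_hull_def mem_Collect_eq by metis
    obtain l' r where r: "strict_mono r" and l': "l' \<in> std_simplex" "supp l' \<subseteq> active_set h x"
      and lim: "(\<lambda>\<nu>. \<Sum>i\<in>UNIV. l (r \<nu>) i *\<^sub>R gradient (h i) (xs (s (r \<nu>))))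
         \<longlonglongrightarrow> (\<Sum>i\<in>UNIV. l' i *\<^sub>R gradient (h i) x)"
      and ev: "\<forall>\<^sub>F \<nu> in sequentially. supp l' \<subseteq> supp (l (r \<nu>))"
      by (rule multipliers_limit[where h = h and l = l, OF h xss l(1,2)])
    have "((\<lambda>n. vs (s n)) \<circ> r) \<longlonglongrightarrow> (\<Sum>i\<in>UNIV. l' i *\<^sub>R gradient (h i) x)"
      using lim by (simp add: l(3) o_def)
    then have "(\<Sum>i\<in>UNIV. l' i *\<^sub>R gradient (h i) x) = 0"
      using LIMSEQ_subseq_LIMSEQ[OF vss r] by (rule LIMSEQ_unique)
    then have "l' \<in> critical_multipliers h x" using l' by (simp add: critical_multipliers_def)
    moreover obtain n where "supp l' \<subseteq> supp (l (r n))"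
      using ev unfolding eventually_sequentially by blast
    ultimately have "xs (s (r n)) \<in> critical_region h x"
      unfolding critical_region_def using l(2) by blast
    then show False using s(2) by blast
  qed
qed

text \<open>
  Fix one critical multiplier for each of the finitely many supports. Combining the gradients at
  a nearby point \<open>y\<close> with the multiplier whose support is active at \<open>y\<close> gives a subgradient at \<open>y\<close>,
  and it is small since the combination vanishes at \<open>x\<close>.
\<close>

lemma critical_region_locally_minimal:
  fixes h :: "'i::finite \<Rightarrow> 'a::euclidean_space \<Rightarrow> real"
  assumes h: "\<And>i y. C11_at (h i) y" and N: "identifiable (max_fun h) x 0 N"
  shows "\<forall>\<^sub>F y in nhds x. y \<in> critical_region h x \<longrightarrow> y \<in> N"
proof -
  obtain e where "0 < e" and e: "\<And>y u. dist y x < e \<Longrightarrow> dist u 0 < e \<Longrightarrow>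
      u \<in> limiting_subdifferential (max_fun h) y \<Longrightarrow> y \<in> N"
    using identifiable_uniform[OF N] by metis
  define \<S> where "\<S> = supp ` critical_multipliers h x"
  have "\<forall>K\<in>\<S>. \<exists>l. l \<in> critical_multipliers h x \<and> supp l = K" by (auto simp: \<S>_def)
  then obtain l where l: "\<And>K. K \<in> \<S> \<Longrightarrow> l K \<in> critical_multipliers h x" "\<And>K. K \<in> \<S> \<Longrightarrow> supp (l K) = K"
    by metis
  define w where "w K y = (\<Sum>i\<in>UNIV. l K i *\<^sub>R gradient (h i) y)" for K y
  have "(w K \<longlongrightarrow> 0) (nhds x)" if "K \<in> \<S>" for K
  proof -
    have "(gradient (h i) \<longlongrightarrow> gradient (h i) x) (nhds x)" for i
      using C11_at_isCont_gradient[OF h] by (simp add: tendsto_nhds_iff isCont_def)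
    then have "(w K \<longlongrightarrow> (\<Sum>i\<in>UNIV. l K i *\<^sub>R gradient (h i) x)) (nhds x)"
      unfolding w_def by (intro tendsto_intros)
    then show ?thesis using l(1)[OF that] by (simp add: critical_multipliers_def)
  qed
  then have "\<forall>\<^sub>F y in nhds x. dist (w K y) 0 < e" if "K \<in> \<S>" for K
    using that \<open>0 < e\<close> tendstoD by blast
  then have "\<forall>\<^sub>F y in nhds x. \<forall>K\<in>\<S>. dist (w K y) 0 < e"
    by (intro eventually_ball_finite) auto
  moreover have "\<forall>\<^sub>F y in nhds x. dist y x < e"
    using \<open>0 < e\<close> eventually_nhds_metric by blast
  ultimately show ?thesis
  proof eventually_elim
    case (elim y)
    show ?case
    proof
      assume "y \<in> critical_region h x"
      then obtain k where "k \<in> critical_multipliers h x" "supp k \<subseteq> active_set h y"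
        unfolding critical_region_def by blast
      then have K: "supp k \<in> \<S>" "supp (l (supp k)) \<subseteq> active_set h y" by (auto simp: \<S>_def l(2))
      then have "w (supp k) y \<in> active_gradient_hull h y"
        unfolding w_def using l(1) by (intro active_gradient_hullI) (auto simp: critical_multipliers_def)
      then have "w (supp k) y \<in> limiting_subdifferential (max_fun h) y"
        using active_gradient_hull_subset_regular[where h = h, OF h] regular_subdifferential_subset_limiting by blast
      then show "y \<in> N" using e elim K(1) by blast
    qed
  qed
qed

section \<open>Local minimality of identifiable manifolds\<close>

text \<open>
  In a chart that flattens \<open>X\<close> to a linear subspace \<open>L\<close>, project linearly onto \<open>L\<close>.
\<close>

lemma C2_submanifold_local_retraction:
  fixes X :: "'a::euclidean_space set"
  assumes "C2_submanifold X" and "x \<in> X"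
  obtains p where "C11_at p x" "p x = x" "\<forall>\<^sub>F y in nhds x. p y \<in> X"
    "\<forall>\<^sub>F y in nhds x. y \<in> X \<longrightarrow> p y = y"
proof -
  obtain U V \<phi> and \<psi> :: "'a \<Rightarrow> 'a" and L where x: "x \<in> U" and \<phi>: "C2_on_open U \<phi>" and \<psi>: "C2_on_open V \<psi>"
    and hom: "homeomorphism U V \<phi> \<psi>" and L: "subspace L" and im: "\<phi> ` (X \<inter> U) = L \<inter> V"
    using assms unfolding C2_submanifold_def by metis
  have open': "open U" "open V" using \<phi> \<psi> by (auto simp: C2_on_open_def)
  obtain P :: "'a \<Rightarrow> 'a" where P: "range P \<subseteq> L" "linear P" "\<And>v. v \<in> L \<Longrightarrow> P v = v"
    using linear_exists_left_inverse_on[OF linear_id L] by auto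
  define p where "p = \<psi> \<circ> (P \<circ> \<phi>)"
  have fx: "\<phi> x \<in> L" "\<phi> x \<in> V" using im x assms(2) by auto
  have \<psi>\<phi>: "\<psi> (\<phi> y) = y" if "y \<in> U" for y using hom that by (auto simp: homeomorphism_def)
  have cPf: "C11_at (P \<circ> \<phi>) x"
    using C11_at_compose[OF C2_on_open_imp_C11_at[OF \<phi> x]] C11_at_linear P(2)
    by (metis linear_conv_bounded_linear)
  show thesis
  proof (rule that)
    show "C11_at p x" unfolding p_def
      by (rule C11_at_compose[OF cPf]) (use C2_on_open_imp_C11_at[OF \<psi> fx(2)] P(3)[OF fx(1)] in simp)
    show "p x = x" by (simp add: p_def P(3)[OF fx(1)] \<psi>\<phi>[OF x])
    have "((P \<circ> \<phi>) \<longlongrightarrow> (P \<circ> \<phi>) x) (nhds x)"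
      using C11_at_isCont[OF cPf] by (simp add: tendsto_nhds_iff isCont_def)
    then have "\<forall>\<^sub>F y in nhds x. (P \<circ> \<phi>) y \<in> V"
      by (rule topological_tendstoD) (use open' fx P(3) in auto)
    then show "\<forall>\<^sub>F y in nhds x. p y \<in> X"
    proof eventually_elim
      case (elim y)
      then have "P (\<phi> y) \<in> \<phi> ` (X \<inter> U)" using im P(1) by auto
      then show ?case using \<psi>\<phi> by (auto simp: p_def)
    qed
    have "\<forall>\<^sub>F y in nhds x. y \<in> U" using open'(1) x by (simp add: eventually_nhds_in_open)
    then show "\<forall>\<^sub>F y in nhds x. y \<in> X \<longrightarrow> p y = y"
    proof eventually_elim
      case (elim y)
      show ?case
      proof
        assume "y \<in> X"
        then have "\<phi> y \<in> L" using im elim by blast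
        then show "p y = y" using \<psi>\<phi>[OF elim] by (simp add: p_def P(3))
      qed
    qed
  qed
qed

lemma gradient_eq_0_quadratic_minorant:
  fixes f :: "'a::euclidean_space \<Rightarrow> real"
  assumes "f differentiable at x" and "\<forall>\<^sub>F y in nhds x. f y \<ge> f x - K * (norm (y - x))\<^sup>2"
  shows "gradient f x = 0"
proof -
  let ?G = "\<lambda>y. f y + K * ((y - x) \<bullet> (y - x))"
  have "(?G has_derivative (\<lambda>d. gradient f x \<bullet> d)) (at x)"
    by (rule has_derivative_eq_rhs)
       (auto intro!: derivative_eq_intros has_derivative_gradient[OF assms(1)])
  moreover have "\<forall>\<^sub>F y in at x. ?G x \<le> ?G y"
    using assms(2) unfolding eventually_nhds_conv_at power2_norm_eq_inner by (auto elim: eventually_mono)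
  ultimately have "(\<lambda>d. gradient f x \<bullet> d) = (\<lambda>d. 0)"
    by (rule has_derivative_local_min)
  then show ?thesis by (metis inner_eq_zero_iff)
qed

text \<open>
  Compose a local \<open>C2\<close> extension of \<open>f\<close> with the retraction onto \<open>X\<close>. The value at \<open>y\<close> is then a
  value of \<open>f\<close> at a point at distance \<open>O(|y - x|)\<close> from \<open>x\<close>, so the quadratic minorant of \<open>f\<close> passes
  to the extension, whose gradient at \<open>x\<close> must vanish. An arbitrary extension of the restriction
  could have a nonzero normal gradient component.
\<close>

lemma C2_restriction_extension:
  fixes f :: "'a::euclidean_space \<Rightarrow> real"
  assumes X: "C2_submanifold X" and f: "C2_on X f" and x: "x \<in> X"
    and minorant: "\<forall>\<^sub>F y in nhds x. f y \<ge> f x - r * (norm (y - x))\<^sup>2"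
  obtains k where "C11_at k x" "gradient k x = 0" "\<forall>\<^sub>F y in nhds x. y \<in> X \<longrightarrow> k y = f y"
proof -
  obtain V h where V: "x \<in> V" "C2_on_open V h" "\<And>y. y \<in> X \<inter> V \<Longrightarrow> h y = f y"
    using f x unfolding C2_on_def by metis
  obtain p where p: "C11_at p x" "p x = x" "\<forall>\<^sub>F y in nhds x. p y \<in> X"
    "\<forall>\<^sub>F y in nhds x. y \<in> X \<longrightarrow> p y = y"
    using C2_submanifold_local_retraction[OF X x] by metis
  have lim: "(p \<longlongrightarrow> x) (nhds x)"
    using C11_at_isCont[OF p(1)] p(2) by (simp add: tendsto_nhds_iff isCont_def)
  have "open V" using V(2) by (simp add: C2_on_open_def)
  then have "\<forall>\<^sub>F y in nhds x. p y \<in> V" using lim V(1) topological_tendstoD by blast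
  with p(3) have kf: "\<forall>\<^sub>F y in nhds x. (h \<circ> p) y = f (p y)"
    by eventually_elim (simp add: V(3))
  have k: "C11_at (h \<circ> p) x"
    using C11_at_compose[OF p(1)] C2_on_open_imp_C11_at[OF V(2,1)] by (simp add: p(2))
  obtain \<delta> A where A: "0 < \<delta>" "\<And>y. y \<in> ball x \<delta> \<Longrightarrow> norm (p y - p x) \<le> A * norm (y - x)"
    using C11_atE[OF p(1)] centre_in_ball by metis
  then have "\<forall>\<^sub>F y in nhds x. norm (p y - x) \<le> A * norm (y - x)"
    unfolding eventually_nhds_metric by (intro exI[of _ \<delta>]) (auto simp: p(2) dist_commute)
  moreover have "\<forall>\<^sub>F y in nhds x. f (p y) \<ge> f x - r * (norm (p y - x))\<^sup>2"
    using minorant lim by (rule eventually_compose_filterlim)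
  ultimately have "\<forall>\<^sub>F y in nhds x. (h \<circ> p) y \<ge> (h \<circ> p) x - (\<bar>r\<bar> * A\<^sup>2) * (norm (y - x))\<^sup>2"
    using kf
  proof eventually_elim
    case (elim y)
    have "r * (norm (p y - x))\<^sup>2 \<le> \<bar>r\<bar> * (A * norm (y - x))\<^sup>2"
      using elim(1) by (intro mult_mono power_mono) auto
    moreover have "h x = f x" using V(3)[of x] x V(1) by simp
    ultimately show ?case using elim(2,3) by (simp add: p(2) power_mult_distrib mult.assoc)
  qed
  then have "gradient (h \<circ> p) x = 0"
    using gradient_eq_0_quadratic_minorant C11_at_differentiable[OF k] by blast
  moreover have "\<forall>\<^sub>F y in nhds x. y \<in> X \<longrightarrow> (h \<circ> p) y = f y"
    using kf p(4) by eventually_elim auto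
  ultimately show thesis using that[OF k] by blast
qed

text \<open>
  Every point \<open>x'\<close> of \<open>M\<close> near \<open>x\<close> carries a small subgradient: the gradient \<open>v\<close> of the extension
  \<open>k\<close> of the restriction of \<open>f\<close> to \<open>M\<close>. This is shown by minimizing \<open>f\<close>, tilted by \<open>v\<close> and penalized
  quadratically around \<open>x'\<close>. The penalty constant \<open>K\<close> exceeds both the constant \<open>r\<close> of the minorant,
  which keeps the minimizer near \<open>x\<close>, and the constant \<open>C\<close> in the quadratic bound for \<open>k\<close>, which
  makes \<open>x'\<close> the only minimizer on \<open>M\<close>.
\<close>

lemma identifiable_manifold_locally_minimal:
  fixes f :: "'a::euclidean_space \<Rightarrow> real"
  assumes cont: "\<And>y. isCont f y"
    and minorant: "\<forall>\<^sub>F y in nhds x. f y \<ge> f x - r * (norm (y - x))\<^sup>2"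
    and M: "C2_identifiable_manifold f x 0 M" and N: "identifiable f x 0 N"
  shows "\<forall>\<^sub>F x' in nhds x. x' \<in> M \<longrightarrow> x' \<in> N"
proof -
  have idM: "identifiable f x 0 M" using M by (simp add: C2_identifiable_manifold_def)
  obtain U where U: "open U" "x \<in> U" "C2_submanifold (M \<inter> U)" "C2_on (M \<inter> U) f"
    using M unfolding C2_identifiable_manifold_def by blast
  have "x \<in> M \<inter> U" using idM U(2) by (simp add: identifiable_def)
  then obtain k where k: "C11_at k x" "gradient k x = 0" and "\<forall>\<^sub>F y in nhds x. y \<in> M \<inter> U \<longrightarrow> k y = f y"
    using C2_restriction_extension[OF U(3,4) _ minorant] by metis
  moreover have "\<forall>\<^sub>F y in nhds x. y \<in> U" using U(1,2) by (rule eventually_nhds_in_open)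
  ultimately have kf: "\<forall>\<^sub>F y in nhds x. y \<in> M \<longrightarrow> k y = f y"
    by (auto elim: eventually_elim2)
  obtain \<delta>1 C where \<delta>1: "0 < \<delta>1" "0 \<le> C" and "\<And>y. y \<in> ball x \<delta>1 \<Longrightarrow> C11_at k y"
    and C: "\<And>y z. y \<in> ball x \<delta>1 \<Longrightarrow> z \<in> ball x \<delta>1 \<Longrightarrow>
      norm (k z - k y - deriv1 k y (z - y)) \<le> C * (norm (z - y))\<^sup>2"
    using C11_at_quadratic_bound[OF k(1)] by metis
  then have dk: "deriv1 k y = (\<lambda>d. gradient k y \<bullet> d)" if "y \<in> ball x \<delta>1" for y
    using frechet_derivative_at[OF has_derivative_gradient[OF C11_at_differentiable]] that by metis
  obtain \<delta>2 where \<delta>2: "0 < \<delta>2"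
    "\<And>y. dist y x < \<delta>2 \<Longrightarrow> f y \<ge> f x - r * (norm (y - x))\<^sup>2 \<and> (y \<in> M \<longrightarrow> k y = f y)"
    using eventually_conj[OF minorant kf] unfolding eventually_nhds_metric by blast
  (* Halving makes the closed ball of radius \<delta> fit into both open balls. *)
  define \<delta> where "\<delta> = min \<delta>1 \<delta>2 / 2"
  have \<delta>: "0 < \<delta>" "\<delta> < \<delta>1" "\<delta> < \<delta>2" using \<delta>1(1) \<delta>2(1) by (auto simp: \<delta>_def)
  obtain e where e: "0 < e"
    "\<And>y u. dist y x < e \<Longrightarrow> dist u 0 < e \<Longrightarrow> u \<in> limiting_subdifferential f y \<Longrightarrow> y \<in> M"
    using identifiable_uniform[OF idM] by metis
  obtain e' where e': "0 < e'"
    "\<And>y u. dist y x < e' \<Longrightarrow> dist u 0 < e' \<Longrightarrow> u \<in> limiting_subdifferential f y \<Longrightarrow> y \<in> N"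
    using identifiable_uniform[OF N] by metis
  define K where "K = \<bar>r\<bar> + C + 1"
  have K: "0 < K" "C < K" "r + 1 \<le> K" using \<delta>1(2) by (auto simp: K_def)
  (* The minimizer will be within \<eta> of x, and then its distance to x' is below 2 \<eta>; the last
     entry makes 2 K (2 \<eta>), which bounds the contribution of the penalty, at most e / 2. *)
  define \<eta> where "\<eta> = min (min \<delta> e) (e / (8 * K))"
  have \<eta>: "0 < \<eta>" "\<eta> \<le> \<delta>" "\<eta> \<le> e"
    using \<delta>(1) e(1) K(1) by (auto simp: \<eta>_def)
  have "\<eta> \<le> e / (8 * K)" by (simp add: \<eta>_def)
  then have K\<eta>: "4 * K * \<eta> \<le> e / 2" using K(1) by (simp add: field_simps)
  have grad0: "(gradient k \<longlongrightarrow> 0) (nhds x)"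
    using C11_at_isCont_gradient[OF k(1)] k(2) by (simp add: tendsto_nhds_iff isCont_def)
  have fx: "(f \<longlongrightarrow> f x) (nhds x)"
    using cont[of x] by (simp add: tendsto_nhds_iff isCont_def)
  have "((\<lambda>x'. f x' - f x + 2 * \<delta> * norm (gradient k x') + 2 * K * \<delta> * norm (x' - x))
      \<longlongrightarrow> f x - f x + 2 * \<delta> * norm (0 :: 'a) + 2 * K * \<delta> * norm (x - x)) (nhds x)"
    by (intro tendsto_intros fx grad0 filterlim_ident)
  (* This quantity will bound the squared distance of the minimizer to x. *)
  then have small: "\<forall>\<^sub>F x' in nhds x.
      f x' - f x + 2 * \<delta> * norm (gradient k x') + 2 * K * \<delta> * norm (x' - x) < \<eta>\<^sup>2"
    using \<eta>(1) unfolding order_tendsto_iff by simp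
  have "\<forall>\<^sub>F x' in nhds x. dist (gradient k x') 0 < min e' (e / 2)"
    using e(1) e'(1) by (intro tendstoD[OF grad0]) auto
  moreover have "\<forall>\<^sub>F x' in nhds x. dist x' x < min e' \<eta>"
    using e'(1) \<eta>(1) eventually_nhds_metric by (metis min_less_iff_conj)
  ultimately show ?thesis using small
  proof eventually_elim
    case (elim x')
    define v where "v = gradient k x'"
    have v: "norm v < e'" "norm v < e / 2" and x': "dist x' x < e'" "dist x' x < \<eta>"
      using elim(1,2) by (auto simp: v_def)
    show ?case
    proof
      assume "x' \<in> M"
      define \<Phi> where "\<Phi> y = f y - v \<bullet> (y - x') + K * (norm (y - x'))\<^sup>2" for y
      have "continuous_on (cball x \<delta>) \<Phi>"
        unfolding \<Phi>_def using cont by (intro continuous_intros) (auto intro: continuous_at_imp_continuous_on)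
      then obtain y where y: "y \<in> cball x \<delta>" "\<And>z. z \<in> cball x \<delta> \<Longrightarrow> \<Phi> y \<le> \<Phi> z"
        using continuous_attains_inf[OF compact_cball, of x \<delta> \<Phi>] \<delta>(1) by auto
      have x'in: "x' \<in> cball x \<delta>" using x'(2) \<eta>(2) by (simp add: dist_commute)
      have \<Phi>y: "f y - v \<bullet> (y - x') + K * (norm (y - x'))\<^sup>2 \<le> f x'"
        using y(2)[OF x'in] by (simp add: \<Phi>_def)
      have y_near: "norm (y - x) < \<eta>"
      proof -
        have a: "norm (y - x) \<le> \<delta>" using y(1) by (simp add: dist_norm norm_minus_commute)
        have "norm (y - x') \<le> 2 * \<delta>"
          using dist_triangle[of y x' x] y(1) x'in by (simp add: dist_norm norm_minus_commute)
        then have 1: "v \<bullet> (y - x') \<le> 2 * \<delta> * norm v"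
          using norm_cauchy_schwarz[of v "y - x'"] mult_left_mono[of "norm (y - x')" "2 * \<delta>" "norm v"]
          by (simp add: mult.commute)
        have "(y - x) \<bullet> (x' - x) \<le> \<delta> * norm (x' - x)"
          using norm_cauchy_schwarz[of "y - x" "x' - x"] mult_right_mono[OF a, of "norm (x' - x)"] by simp
        moreover have "(norm (y - x'))\<^sup>2 = (norm (y - x))\<^sup>2 - 2 * ((y - x) \<bullet> (x' - x)) + (norm (x' - x))\<^sup>2"
          unfolding power2_norm_eq_inner by (simp add: inner_diff inner_commute algebra_simps)
        ultimately have "(norm (y - x'))\<^sup>2 \<ge> (norm (y - x))\<^sup>2 - 2 * \<delta> * norm (x' - x)"
          using zero_le_power2[of "norm (x' - x)"] by linarith
        then have "K * ((norm (y - x))\<^sup>2 - 2 * \<delta> * norm (x' - x)) \<le> K * (norm (y - x'))\<^sup>2"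
          using K(1) by (intro mult_left_mono) auto
        then have 2: "K * (norm (y - x'))\<^sup>2 \<ge> K * (norm (y - x))\<^sup>2 - 2 * K * \<delta> * norm (x' - x)"
          by (simp add: algebra_simps)
        have 3: "f y \<ge> f x - r * (norm (y - x))\<^sup>2"
          using \<delta>2(2)[of y] y(1) \<delta>(3) by (simp add: dist_commute)
        have "(norm (y - x))\<^sup>2 \<le> (K - r) * (norm (y - x))\<^sup>2"
          using K(3) mult_right_mono[of 1 "K - r" "(norm (y - x))\<^sup>2"] by simp
        also have "\<dots> \<le> f x' - f x + 2 * \<delta> * norm v + 2 * K * \<delta> * norm (x' - x)"
          using \<Phi>y 1 2 3 by (simp add: left_diff_distrib)
        also have "\<dots> < \<eta>\<^sup>2" using elim(3) by (simp add: v_def)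
        finally show ?thesis using \<eta>(1) by (simp add: power_less_imp_less_base)
      qed
      have yx': "norm (y - x') < 2 * \<eta>"
        using y_near x'(2) norm_triangle_ineq4[of "y - x" "x' - x"] by (simp add: dist_norm)
      define u where "u = v - (2 * K) *\<^sub>R (y - x')"
      (* First-order condition at the interior minimizer y of \<Phi>. *)
      have "u \<in> regular_subdifferential f y"
      proof (rule regular_subdifferentialI_quadratic[where K = K])
        have "y \<in> ball x \<delta>" using y_near \<eta>(2) by (simp add: dist_norm norm_minus_commute)
        then have "\<forall>\<^sub>F z in nhds y. z \<in> ball x \<delta>"
          by (rule eventually_nhds_in_open[OF open_ball])
        then show "\<forall>\<^sub>F z in nhds y. f y + u \<bullet> (z - y) - K * (norm (z - y))\<^sup>2 \<le> f z"
        proof eventually_elim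
          case (elim z)
          have "\<Phi> y \<le> \<Phi> z" using y(2) elim by simp
          moreover have "(norm (z - x'))\<^sup>2 = (norm (y - x'))\<^sup>2 + 2 * ((y - x') \<bullet> (z - y)) + (norm (z - y))\<^sup>2"
            unfolding power2_norm_eq_inner by (simp add: inner_diff inner_commute algebra_simps)
          ultimately show ?case
            by (simp add: \<Phi>_def u_def inner_diff inner_commute algebra_simps)
        qed
      qed
      then have u: "u \<in> limiting_subdifferential f y"
        using regular_subdifferential_subset_limiting by blast
      have "norm u \<le> norm v + 2 * K * norm (y - x')"
        using norm_triangle_ineq4[of v "(2 * K) *\<^sub>R (y - x')"] K(1) by (simp add: u_def)
      also have "\<dots> < e / 2 + 2 * K * (2 * \<eta>)"
        using v(2) yx' K(1) by (intro add_strict_mono mult_strict_left_mono) auto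
      also have "\<dots> \<le> e" using K\<eta> by simp
      finally have "y \<in> M" using e(2)[of y u] u y_near \<eta>(3) by (simp add: dist_norm)
      have yb: "y \<in> ball x \<delta>1" "x' \<in> ball x \<delta>1" "dist y x < \<delta>2" "dist x' x < \<delta>2"
        using y(1) x'in \<delta> by (auto simp: dist_commute)
      have "k y = f y" "k x' = f x'" using \<delta>2(2) yb \<open>y \<in> M\<close> \<open>x' \<in> M\<close> by auto
      then have "f y \<ge> f x' + v \<bullet> (y - x') - C * (norm (y - x'))\<^sup>2"
        using C[OF yb(2,1)] by (simp add: dk[OF yb(2)] v_def abs_le_iff)
      then have "(K - C) * (norm (y - x'))\<^sup>2 \<le> 0" using \<Phi>y by (simp add: left_diff_distrib)
      then have "y = x'" using K(2) by (simp add: mult_le_0_iff)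
      then have "v \<in> limiting_subdifferential f x'" using u by (simp add: u_def)
      then show "x' \<in> N" using e'(2) x'(1) v(1) by simp
    qed
  qed
qed

lemma C2_on_open_subset: "C2_on_open V f \<Longrightarrow> open U \<Longrightarrow> U \<subseteq> V \<Longrightarrow> C2_on_open U f"
  unfolding C2_on_open_def by (meson continuous_on_subset subsetD)

text \<open>
  Shrink the domains of the charts.
\<close>

lemma C2_submanifold_Int_open:
  assumes X: "C2_submanifold X" and O': "open O'"
  shows "C2_submanifold (X \<inter> O')"
proof -
  obtain k where k: "\<And>p. p \<in> X \<Longrightarrow> \<exists>U V \<phi> \<psi> L. p \<in> U \<and> C2_on_open U \<phi> \<and> C2_on_open V (\<psi> :: 'a \<Rightarrow> 'a) \<and>
      homeomorphism U V \<phi> \<psi> \<and> subspace L \<and> dim L = k \<and> \<phi> ` (X \<inter> U) = L \<inter> V"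
    using X unfolding C2_submanifold_def by metis
  show ?thesis
    unfolding C2_submanifold_def
  proof (intro exI[of _ k] ballI)
    fix p assume p: "p \<in> X \<inter> O'"
    obtain U V \<phi> \<psi> L where c: "p \<in> U" "C2_on_open U \<phi>" "C2_on_open V (\<psi> :: 'a \<Rightarrow> 'a)"
      "homeomorphism U V \<phi> \<psi>" "subspace L" "dim L = k" "\<phi> ` (X \<inter> U) = L \<inter> V"
      using k[of p] p by blast
    have op: "open U" "open V" using c(2,3) by (auto simp: C2_on_open_def)
    have "\<phi> ` (U \<inter> O') = V \<inter> \<psi> -` O'"
      using c(4) unfolding homeomorphism_def by (auto simp: image_iff)
    moreover have "open (V \<inter> \<psi> -` O')"
      using c(4) op(2) O' by (intro continuous_open_preimage) (auto simp: homeomorphism_def)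
    ultimately have V': "open (\<phi> ` (U \<inter> O'))" "\<phi> ` (U \<inter> O') \<subseteq> V" by auto
    have inj: "inj_on \<phi> U" using c(4) unfolding homeomorphism_def by (intro inj_on_inverseI[of _ \<psi>]) auto
    have "\<phi> ` (X \<inter> O' \<inter> (U \<inter> O')) = \<phi> ` (X \<inter> U) \<inter> \<phi> ` (U \<inter> O')"
      using inj unfolding inj_on_def by blast
    then have "\<phi> ` (X \<inter> O' \<inter> (U \<inter> O')) = L \<inter> \<phi> ` (U \<inter> O')" using c(7) V'(2) by blast
    moreover have "homeomorphism (U \<inter> O') (\<phi> ` (U \<inter> O')) \<phi> \<psi>"
      by (rule homeomorphism_of_subsets[OF c(4)]) (use V' in auto)
    ultimately show "\<exists>U V \<phi> \<psi> L. p \<in> U \<and> C2_on_open U \<phi> \<and> C2_on_open V (\<psi> :: 'a \<Rightarrow> 'a) \<and>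
      homeomorphism U V \<phi> \<psi> \<and> subspace L \<and> dim L = k \<and> \<phi> ` (X \<inter> O' \<inter> U) = L \<inter> V"
      using c(1,5,6) p C2_on_open_subset[OF c(2), of "U \<inter> O'"] C2_on_open_subset[OF c(3) V'] op(1) O'
      by (intro exI[of _ "U \<inter> O'"] exI[of _ "\<phi> ` (U \<inter> O')"] exI[of _ \<phi>] exI[of _ \<psi>] exI[of _ L]) auto
  qed
qed

lemma C2_identifiable_manifold_cong:
  assumes M: "C2_identifiable_manifold f x v M" and N: "identifiable f x v N"
    and eq: "\<forall>\<^sub>F y in nhds x. y \<in> N \<longleftrightarrow> y \<in> M"
  shows "C2_identifiable_manifold f x v N"
proof -
  obtain U where U: "open U" "x \<in> U" "C2_submanifold (M \<inter> U)" "C2_on (M \<inter> U) f"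
    using M unfolding C2_identifiable_manifold_def by blast
  obtain O' where O': "open O'" "x \<in> O'" "\<And>y. y \<in> O' \<Longrightarrow> y \<in> N \<longleftrightarrow> y \<in> M"
    using eq unfolding eventually_nhds by blast
  have NM: "N \<inter> (U \<inter> O') = M \<inter> U \<inter> O'" using O'(3) by blast
  have "C2_submanifold (N \<inter> (U \<inter> O'))"
    unfolding NM using U(3) O'(1) by (rule C2_submanifold_Int_open)
  moreover have "C2_on (N \<inter> (U \<inter> O')) f"
    unfolding NM using U(4) unfolding C2_on_def by (metis IntD1 IntI Int_assoc Int_commute)
  ultimately show ?thesis
    unfolding C2_identifiable_manifold_def using N U(1,2) O'(1,2)
    by (intro conjI exI[of _ "U \<inter> O'"]) auto
qed

text \<open>
  By local minimality of both sets they coincide near \<open>x\<close>. The quadratic minorant that the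
  previous argument requires comes from representing the subgradient \<open>0\<close> by active gradients.
\<close>

lemma identifiable_manifold_imp_critical_region_manifold:
  fixes h :: "'i::finite \<Rightarrow> 'a::euclidean_space \<Rightarrow> real"
  assumes h: "\<And>i y. C11_at (h i) y" and M: "C2_identifiable_manifold (max_fun h) x 0 M"
  shows "C2_identifiable_manifold (max_fun h) x 0 (critical_region h x)"
proof -
  have idM: "identifiable (max_fun h) x 0 M" using M by (simp add: C2_identifiable_manifold_def)
  then have crit: "0 \<in> limiting_subdifferential (max_fun h) x" by (simp add: identifiable_def)
  then have "0 \<in> active_gradient_hull h x"
    using limiting_subdifferential_max_subset[where h = h, OF h] by blast
  then obtain r where r: "\<forall>\<^sub>F y in nhds x. max_fun h y \<ge> max_fun h x + 0 \<bullet> (y - x) - r * (norm (y - x))\<^sup>2"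
    by (rule max_fun_quadratic_minorant[where h = h, OF h])
  have id: "identifiable (max_fun h) x 0 (critical_region h x)"
    by (rule identifiable_critical_region[where h = h, OF h crit])
  have "isCont (max_fun h) y" for y by (rule isCont_max_fun[where h = h, OF C11_at_isCont[OF h]])
  then have 1: "\<forall>\<^sub>F y in nhds x. y \<in> M \<longrightarrow> y \<in> critical_region h x"
    using r by (intro identifiable_manifold_locally_minimal[OF _ _ M id]) simp_all
  have 2: "\<forall>\<^sub>F y in nhds x. y \<in> critical_region h x \<longrightarrow> y \<in> M"
    by (rule critical_region_locally_minimal[where h = h, OF h idM])
  show ?thesis
    by (rule C2_identifiable_manifold_cong[OF M id]) (use 1 2 in \<open>eventually_elim, blast\<close>)
qed

section \<open>Composition of a finite maximum with a smooth map\<close>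

lemma max_fun_compose: "max_fun g \<circ> F = max_fun (\<lambda>i. g i \<circ> F)"
  by (simp add: max_fun_def fun_eq_iff)

lemma active_set_compose: "active_set (\<lambda>i. g i \<circ> F) x = active_set g (F x)"
  by (simp add: active_set_def max_fun_def)

text \<open>
  The chain rule in the form in which the composite gradients enter the definition of the
  multipliers.
\<close>

lemma gradient_compose:
  fixes F :: "'a::euclidean_space \<Rightarrow> 'b::euclidean_space"
  assumes F: "F differentiable at x" and g: "g differentiable at (F x)"
  shows "gradient (g \<circ> F) x = adjoint (deriv1 F x) (gradient g (F x))"
proof (rule gradient_eqI)
  have F': "(F has_derivative deriv1 F x) (at x)" using F by (simp add: frechet_derivative_works)
  show "((g \<circ> F) has_derivative (\<lambda>d. adjoint (deriv1 F x) (gradient g (F x)) \<bullet> d)) (at x)"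
    by (rule has_derivative_eq_rhs[OF diff_chain_at[OF F' has_derivative_gradient[OF g]]])
       (auto simp: adjoint_clauses[OF has_derivative_linear[OF F']])
qed

lemma minimal_identifiable_set_eq_critical_region:
  fixes F :: "'a::euclidean_space \<Rightarrow> 'b::euclidean_space" and g :: "'i::finite \<Rightarrow> 'b \<Rightarrow> real"
  assumes F: "F differentiable at xbar" and g: "\<And>i. g i differentiable at (F xbar)"
  shows "minimal_identifiable_set F g xbar = critical_region (\<lambda>i. g i \<circ> F) xbar"
proof -
  have lin: "linear (adjoint (deriv1 F xbar))"
    by (intro adjoint_linear linear_frechet_derivative F)
  have "(\<Sum>i\<in>UNIV. l i *\<^sub>R gradient (g i \<circ> F) xbar)
      = adjoint (deriv1 F xbar) (\<Sum>i\<in>active_set g (F xbar). l i *\<^sub>R gradient (g i) (F xbar))"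
    if "supp l \<subseteq> active_set g (F xbar)" for l
  proof -
    have "(\<Sum>i\<in>UNIV. l i *\<^sub>R gradient (g i \<circ> F) xbar)
        = (\<Sum>i\<in>active_set g (F xbar). l i *\<^sub>R gradient (g i \<circ> F) xbar)"
      using that by (intro sum.mono_neutral_right) (auto simp: supp_def)
    then show ?thesis by (simp add: linear_sum[OF lin] linear_scale[OF lin] gradient_compose[OF F g])
  qed
  then have "multipliers F g xbar = critical_multipliers (\<lambda>i. g i \<circ> F) xbar"
    unfolding multipliers_def critical_multipliers_def active_set_compose by auto
  then show ?thesis
    unfolding minimal_identifiable_set_def critical_active_region_def critical_region_def active_set_compose
    by auto
qed

section \<open>Second-order expansions\<close>

lemma C2_on_UNIV_imp_C2_on_open:
  assumes "C2_on UNIV f"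
  obtains V where "x \<in> V" "C2_on_open V f"
proof -
  obtain V h where V: "x \<in> V" "C2_on_open V h" "\<And>y. y \<in> V \<Longrightarrow> h y = f y"
    using assms unfolding C2_on_def by (metis Int_UNIV_left UNIV_I)
  then obtain f' f'' where "open V" and h: "\<And>y. y \<in> V \<Longrightarrow> (h has_derivative blinfun_apply (f' y)) (at y)"
    and h2: "\<forall>y\<in>V. (f' has_derivative blinfun_apply (f'' y)) (at y)" "continuous_on V f''"
    unfolding C2_on_open_def by blast
  have "(f has_derivative blinfun_apply (f' y)) (at y)" if "y \<in> V" for y
    by (rule has_derivative_transform_within_open[OF h[OF that] \<open>open V\<close> that V(3)])
  then have "C2_on_open V f" unfolding C2_on_open_def using \<open>open V\<close> h2 by blast
  then show thesis using that V(1) by blast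
qed

text \<open>
  The classical first and second derivatives agree with the bounded linear maps of the
  definition. The order of the two arguments of the second derivative is reversed.
\<close>

lemma C2_on_openE:
  fixes f :: "'a::real_normed_vector \<Rightarrow> 'b::real_normed_vector"
  assumes "C2_on_open V f"
  obtains f' :: "'a \<Rightarrow> 'a \<Rightarrow>\<^sub>L 'b" and f'' :: "'a \<Rightarrow> 'a \<Rightarrow>\<^sub>L 'a \<Rightarrow>\<^sub>L 'b" where "open V"
    "\<And>y. y \<in> V \<Longrightarrow> (f has_derivative blinfun_apply (f' y)) (at y)"
    "\<And>y. y \<in> V \<Longrightarrow> (f' has_derivative blinfun_apply (f'' y)) (at y)"
    "\<And>y. y \<in> V \<Longrightarrow> deriv1 f y = blinfun_apply (f' y)"
    "\<And>y u v. y \<in> V \<Longrightarrow> deriv2 f y u v = f'' y v u"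
proof -
  obtain f' :: "'a \<Rightarrow> 'a \<Rightarrow>\<^sub>L 'b" and f'' :: "'a \<Rightarrow> 'a \<Rightarrow>\<^sub>L 'a \<Rightarrow>\<^sub>L 'b" where V: "open V"
    and d1: "\<And>y. y \<in> V \<Longrightarrow> (f has_derivative blinfun_apply (f' y)) (at y)"
    and d2: "\<And>y. y \<in> V \<Longrightarrow> (f' has_derivative blinfun_apply (f'' y)) (at y)"
    using assms unfolding C2_on_open_def by blast
  have e1: "deriv1 f y = blinfun_apply (f' y)" if "y \<in> V" for y
    using frechet_derivative_at[OF d1[OF that]] by simp
  have e2: "deriv2 f y u v = f'' y v u" if y: "y \<in> V" for y u v
  proof -
    have "((\<lambda>y. blinfun_apply (f' y) u) has_derivative (\<lambda>v. f'' y v u)) (at y)"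
      using d2[OF y] by (rule bounded_linear.has_derivative[OF blinfun.bounded_linear_left])
    then have "((\<lambda>y. deriv1 f y u) has_derivative (\<lambda>v. f'' y v u)) (at y)"
      by (rule has_derivative_transform_within_open[OF _ V y]) (simp add: e1)
    then show ?thesis unfolding deriv2_def by (simp add: frechet_derivative_at[symmetric])
  qed
  show thesis by (rule that[OF V d1 d2 e1 e2])
qed

text \<open>
  Restricting to the segment from \<open>x\<close> to \<open>x + d\<close> reduces the expansion to the mean value inequality
  in one real variable. The
  quotient is \<open>0\<close> at \<open>d = 0\<close>, so the limit may be taken over full neighbourhoods.
\<close>

lemma C2_on_open_Taylor2:
  fixes f :: "'a::real_normed_vector \<Rightarrow> 'b::real_normed_vector"
  assumes "C2_on_open V f" and x: "x \<in> V"
  shows "((\<lambda>d. (f (x + d) - (f x + deriv1 f x d + (1/2) *\<^sub>R deriv2 f x d d)) /\<^sub>R (norm d)\<^sup>2) \<longlongrightarrow> 0) (nhds 0)"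
proof -
  obtain f' f'' where V: "open V"
    and d1: "\<And>y. y \<in> V \<Longrightarrow> (f has_derivative blinfun_apply (f' y)) (at y)"
    and d2: "\<And>y. y \<in> V \<Longrightarrow> (f' has_derivative blinfun_apply (f'' y)) (at y)"
    and e1: "\<And>y. y \<in> V \<Longrightarrow> deriv1 f y = blinfun_apply (f' y)"
    and e2: "\<And>y u v. y \<in> V \<Longrightarrow> deriv2 f y u v = f'' y v u"
    using C2_on_openE[OF assms(1)] by metis
  obtain r where r: "0 < r" "ball x r \<subseteq> V" using V x open_contains_ball by blast
  show ?thesis
  proof (rule tendstoI)
    fix \<epsilon> :: real assume "0 < \<epsilon>"
    then have "0 < \<epsilon> / 2" by simp
    then obtain s where s: "0 < s"
      "\<And>y. norm (y - x) < s \<Longrightarrow> norm (f' y - f' x - f'' x (y - x)) \<le> \<epsilon> / 2 * norm (y - x)"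
      using d2[OF x] unfolding has_derivative_at_alt by metis
    have bound: "norm (f (x + d) - (f x + deriv1 f x d + (1/2) *\<^sub>R deriv2 f x d d)) \<le> \<epsilon> / 2 * (norm d)\<^sup>2"
      if d: "norm d < min r s" for d
    proof -
      (* The second-order remainder along the segment; its derivative is o(|d|^2) by
         differentiability of f' at x. *)
      define \<phi> where "\<phi> t = f (x + t *\<^sub>R d) - t *\<^sub>R f' x d - (t\<^sup>2 / 2) *\<^sub>R f'' x d d" for t
      have "norm (\<phi> 1 - \<phi> 0) \<le> (\<epsilon> / 2 * (norm d)\<^sup>2) * norm (1 - 0 :: real)"
      proof (rule differentiable_bound[where f' = "\<lambda>t h. h *\<^sub>R (f' (x + t *\<^sub>R d) - f' x - f'' x (t *\<^sub>R d)) d"])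
        fix t :: real assume t: "t \<in> {0..1}"
        have td: "norm (t *\<^sub>R d) \<le> norm d" using t by (simp add: mult_left_le_one_le)
        then have "x + t *\<^sub>R d \<in> V" using d r by (auto simp: dist_norm)
        then have D1: "((\<lambda>t. f (x + t *\<^sub>R d)) has_derivative (\<lambda>h. f' (x + t *\<^sub>R d) (h *\<^sub>R d))) (at t within {0..1})"
          by (intro has_derivative_compose[where g = f and f = "\<lambda>t. x + t *\<^sub>R d"])
             (auto intro!: derivative_eq_intros d1)
        have D2: "((\<lambda>t. t *\<^sub>R f' x d) has_derivative (\<lambda>h. h *\<^sub>R f' x d)) (at t within {0..1})"
          by (auto intro!: derivative_eq_intros)
        have D3: "((\<lambda>t. (t\<^sup>2 / 2) *\<^sub>R f'' x d d) has_derivative (\<lambda>h. (h * t) *\<^sub>R f'' x d d)) (at t within {0..1})"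
          by (auto intro!: derivative_eq_intros)
        show "(\<phi> has_derivative (\<lambda>h. h *\<^sub>R (f' (x + t *\<^sub>R d) - f' x - f'' x (t *\<^sub>R d)) d)) (at t within {0..1})"
          unfolding \<phi>_def
          by (rule has_derivative_eq_rhs[OF has_derivative_diff[OF has_derivative_diff[OF D1 D2] D3]])
             (simp add: fun_eq_iff blinfun.diff_left blinfun.scaleR_left blinfun.scaleR_right scaleR_diff_right)
        have "norm ((f' (x + t *\<^sub>R d) - f' x - f'' x (t *\<^sub>R d)) d)
            \<le> norm (f' (x + t *\<^sub>R d) - f' x - f'' x (t *\<^sub>R d)) * norm d"
          by (rule norm_blinfun)
        also have "\<dots> \<le> (\<epsilon> / 2 * norm d) * norm d"
        proof (rule mult_right_mono)
          have "norm (f' (x + t *\<^sub>R d) - f' x - f'' x (t *\<^sub>R d)) \<le> \<epsilon> / 2 * norm (t *\<^sub>R d)"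
            using s(2)[of "x + t *\<^sub>R d"] td d by simp
          also have "\<dots> \<le> \<epsilon> / 2 * norm d" using td \<open>0 < \<epsilon>\<close> by (intro mult_left_mono) auto
          finally show "norm (f' (x + t *\<^sub>R d) - f' x - f'' x (t *\<^sub>R d)) \<le> \<epsilon> / 2 * norm d" .
        qed simp
        finally have A: "norm ((f' (x + t *\<^sub>R d) - f' x - f'' x (t *\<^sub>R d)) d) \<le> \<epsilon> / 2 * (norm d)\<^sup>2"
          by (simp only: power2_eq_square mult.assoc)
        show "onorm (\<lambda>h. h *\<^sub>R (f' (x + t *\<^sub>R d) - f' x - f'' x (t *\<^sub>R d)) d) \<le> \<epsilon> / 2 * (norm d)\<^sup>2"
          using mult_left_mono[OF A abs_ge_zero] by (intro onorm_le) (simp add: mult.commute)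
      qed auto
      then show ?thesis by (simp add: \<phi>_def e1[OF x] e2[OF x] algebra_simps)
    qed
    have "dist ((f (x + d) - (f x + deriv1 f x d + (1/2) *\<^sub>R deriv2 f x d d)) /\<^sub>R (norm d)\<^sup>2) 0 < \<epsilon>"
      if d: "norm d < min r s" for d
    proof (cases "d = 0")
      case False
      have scaled: "norm (X /\<^sub>R (norm d)\<^sup>2) \<le> \<epsilon> / 2" if "norm X \<le> \<epsilon> / 2 * (norm d)\<^sup>2" for X :: 'b
        using that False by (simp add: field_simps)
      have "norm ((f (x + d) - (f x + deriv1 f x d + (1/2) *\<^sub>R deriv2 f x d d)) /\<^sub>R (norm d)\<^sup>2) \<le> \<epsilon> / 2"
        by (rule scaled[OF bound[OF d]])
      then show ?thesis unfolding dist_norm diff_zero using \<open>0 < \<epsilon>\<close> by linarith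
    qed (use \<open>0 < \<epsilon>\<close> in simp)
    then show "\<forall>\<^sub>F d in nhds 0. dist ((f (x + d) - (f x + deriv1 f x d + (1/2) *\<^sub>R deriv2 f x d d)) /\<^sub>R (norm d)\<^sup>2) 0 < \<epsilon>"
      using r(1) s(1) unfolding eventually_nhds_metric by (intro exI[of _ "min r s"]) auto
  qed
qed

text \<open>
  A curve with position \<open>p\<close>, velocity \<open>u\<close> and second-order coefficient \<open>w\<close> at time \<open>0\<close>, for positive
  times only, as accessibility gives no information for negative ones.
\<close>

definition expands2 :: "(real \<Rightarrow> 'a::real_normed_vector) \<Rightarrow> 'a \<Rightarrow> 'a \<Rightarrow> 'a \<Rightarrow> bool" where
  "expands2 c p u w \<longleftrightarrow> ((\<lambda>t. (c t - (p + t *\<^sub>R u + t\<^sup>2 *\<^sub>R w)) /\<^sub>R t\<^sup>2) \<longlongrightarrow> 0) (at_right 0)"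

lemma expands2_tendsto_velocity:
  assumes "expands2 c p u w"
  shows "((\<lambda>t. (c t - p) /\<^sub>R t) \<longlongrightarrow> u) (at_right 0)"
proof -
  have "((\<lambda>t. t *\<^sub>R ((c t - (p + t *\<^sub>R u + t\<^sup>2 *\<^sub>R w)) /\<^sub>R t\<^sup>2) + u + t *\<^sub>R w) \<longlongrightarrow> 0 *\<^sub>R 0 + u + 0 *\<^sub>R w) (at_right 0)"
    by (intro tendsto_intros assms[unfolded expands2_def])
  moreover have "\<forall>\<^sub>F t in at_right 0. t *\<^sub>R ((c t - (p + t *\<^sub>R u + t\<^sup>2 *\<^sub>R w)) /\<^sub>R t\<^sup>2) + u + t *\<^sub>R w = (c t - p) /\<^sub>R t"
    using eventually_at_right_less[of 0]
  proof eventually_elim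
    case (elim t)
    then have "t * inverse (t\<^sup>2) = inverse t" "inverse t * t\<^sup>2 = t" "t * (inverse (t\<^sup>2) * t) = 1"
      by (simp_all add: power2_eq_square field_simps)
    then show ?case using elim by (simp add: scaleR_diff_right scaleR_add_right)
  qed
  ultimately show ?thesis by (simp add: Lim_transform_eventually)
qed

lemma expands2_tendsto:
  assumes "expands2 c p u w"
  shows "(c \<longlongrightarrow> p) (at_right 0)"
proof -
  have "((\<lambda>t. t *\<^sub>R ((c t - p) /\<^sub>R t) + p) \<longlongrightarrow> 0 *\<^sub>R u + p) (at_right 0)"
    by (intro tendsto_intros expands2_tendsto_velocity[OF assms])
  moreover have "\<forall>\<^sub>F t in at_right 0. t *\<^sub>R ((c t - p) /\<^sub>R t) + p = c t"
    using eventually_at_right_less[of 0] by eventually_elim simp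
  ultimately show ?thesis by (simp add: Lim_transform_eventually)
qed

text \<open>
  The coefficients are limits of successively rescaled remainders, so they are determined in the
  order position, velocity, second-order coefficient.
\<close>

lemma expands2_unique:
  assumes 1: "expands2 c p u w" and 2: "expands2 c' p' u' w'"
    and eq: "\<forall>\<^sub>F t in at_right 0. c t = c' t"
  shows "w = w'"
proof -
  have "(c' \<longlongrightarrow> p) (at_right 0)"
    by (rule Lim_transform_eventually[OF expands2_tendsto[OF 1] eq])
  then have p: "p = p'" using expands2_tendsto[OF 2] tendsto_unique trivial_limit_at_right_real by blast
  have "\<forall>\<^sub>F t in at_right 0. (c t - p) /\<^sub>R t = (c' t - p) /\<^sub>R t" using eq by eventually_elim simp
  then have "((\<lambda>t. (c' t - p) /\<^sub>R t) \<longlongrightarrow> u) (at_right 0)"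
    by (rule Lim_transform_eventually[OF expands2_tendsto_velocity[OF 1]])
  then have u: "u = u'"
    using expands2_tendsto_velocity[OF 2] tendsto_unique trivial_limit_at_right_real unfolding p by blast
  have "((\<lambda>t. (c t - (p + t *\<^sub>R u + t\<^sup>2 *\<^sub>R w)) /\<^sub>R t\<^sup>2 - (c' t - (p' + t *\<^sub>R u' + t\<^sup>2 *\<^sub>R w')) /\<^sub>R t\<^sup>2) \<longlongrightarrow> 0 - 0) (at_right 0)"
    using 1 2 unfolding expands2_def by (rule tendsto_diff)
  moreover have "\<forall>\<^sub>F t in at_right 0. (c t - (p + t *\<^sub>R u + t\<^sup>2 *\<^sub>R w)) /\<^sub>R t\<^sup>2
      - (c' t - (p' + t *\<^sub>R u' + t\<^sup>2 *\<^sub>R w')) /\<^sub>R t\<^sup>2 = w' - w"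
    using eq eventually_at_right_less[of 0]
    by eventually_elim (simp add: p u power2_eq_square algebra_simps)
  ultimately have "((\<lambda>t::real. w' - w) \<longlongrightarrow> 0) (at_right 0)"
    by (simp add: Lim_transform_eventually)
  then show ?thesis by (simp add: tendsto_const_iff)
qed

text \<open>
  The acceleration term \<open>w\<close> enters through the first derivative and the velocity \<open>u\<close> through the
  second one. The same rule, applied to \<open>F\<close> and then to
  \<open>g i\<close>, produces \<open>eta\<close> and \<open>zeta\<close>.
\<close>

lemma expands2_C2_compose:
  fixes f :: "'a::real_normed_vector \<Rightarrow> 'b::real_normed_vector"
  assumes f: "C2_on_open V f" "x \<in> V" and c: "expands2 c x u w"
  shows "expands2 (\<lambda>t. f (c t)) (f x) (deriv1 f x u) (deriv1 f x w + (1/2) *\<^sub>R deriv2 f x u u)"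
proof -
  obtain f' :: "'a \<Rightarrow> 'a \<Rightarrow>\<^sub>L 'b" and f'' :: "'a \<Rightarrow> 'a \<Rightarrow>\<^sub>L 'a \<Rightarrow>\<^sub>L 'b" where "\<And>y. y \<in> V \<Longrightarrow> deriv1 f y = blinfun_apply (f' y)"
    and "\<And>y u v. y \<in> V \<Longrightarrow> deriv2 f y u v = f'' y v u"
    using C2_on_openE[OF f(1)] by metis
  then have e1: "deriv1 f x = blinfun_apply (f' x)" and e2: "\<And>u v. deriv2 f x u v = f'' x v u"
    using f(2) by auto
  define R where "R d = (f (x + d) - (f x + deriv1 f x d + (1/2) *\<^sub>R deriv2 f x d d)) /\<^sub>R (norm d)\<^sup>2" for d
  have "((\<lambda>t. c t - x) \<longlongrightarrow> x - x) (at_right 0)"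
    by (intro tendsto_intros expands2_tendsto[OF c])
  then have d: "((\<lambda>t. c t - x) \<longlongrightarrow> 0) (at_right 0)" by simp
  have R: "((\<lambda>t. R (c t - x)) \<longlongrightarrow> 0) (at_right 0)"
    unfolding R_def by (rule filterlim_compose[OF C2_on_open_Taylor2[OF f] d])
  (* q is the rescaled velocity and s the rescaled remainder of the curve; the remainder of the
     composition is a continuous expression in them. *)
  define q where "q t = (c t - x) /\<^sub>R t" for t
  have q: "(q \<longlongrightarrow> u) (at_right 0)" unfolding q_def by (rule expands2_tendsto_velocity[OF c])
  define s where "s t = (c t - (x + t *\<^sub>R u + t\<^sup>2 *\<^sub>R w)) /\<^sub>R t\<^sup>2" for t
  have s: "(s \<longlongrightarrow> 0) (at_right 0)" using c unfolding expands2_def s_def .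
  have "((\<lambda>t. (norm (q t))\<^sup>2 *\<^sub>R R (c t - x) + f' x (s t) + (1/2) *\<^sub>R (f'' x (q t) (q t) - f'' x u u))
      \<longlongrightarrow> (norm u)\<^sup>2 *\<^sub>R 0 + f' x 0 + (1/2) *\<^sub>R (f'' x u u - f'' x u u)) (at_right 0)"
    by (intro tendsto_intros R q s)
  moreover have "\<forall>\<^sub>F t in at_right 0.
      (norm (q t))\<^sup>2 *\<^sub>R R (c t - x) + f' x (s t) + (1/2) *\<^sub>R (f'' x (q t) (q t) - f'' x u u)
      = (f (c t) - (f x + t *\<^sub>R deriv1 f x u + t\<^sup>2 *\<^sub>R (deriv1 f x w + (1/2) *\<^sub>R deriv2 f x u u))) /\<^sub>R t\<^sup>2"
    using eventually_at_right_less[of 0]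
  proof eventually_elim
    case (elim t)
    have eqR: "(norm (q t))\<^sup>2 *\<^sub>R R (c t - x)
        = (f (c t) - (f x + f' x (c t - x) + (1/2) *\<^sub>R f'' x (c t - x) (c t - x))) /\<^sub>R t\<^sup>2"
    proof (cases "c t = x")
      case False
      have "(norm (q t))\<^sup>2 = inverse (t\<^sup>2) * (norm (c t - x))\<^sup>2"
        by (simp add: q_def power_mult_distrib power_inverse)
      then show ?thesis using False by (simp add: R_def e1 e2)
    qed (simp add: q_def e1 e2)
    have eq2: "f'' x (q t) (q t) = f'' x (c t - x) (c t - x) /\<^sub>R t\<^sup>2"
      by (simp add: q_def blinfun.scaleR_left blinfun.scaleR_right power2_eq_square)
    have eq1: "f' x (s t) = (f' x (c t - x) - t *\<^sub>R f' x u - t\<^sup>2 *\<^sub>R f' x w) /\<^sub>R t\<^sup>2"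
      by (simp add: s_def blinfun.scaleR_right blinfun.diff_right blinfun.add_right algebra_simps)
    have "inverse (t\<^sup>2) * t\<^sup>2 = 1" using elim by simp
    then show ?case unfolding eqR eq1 eq2 e1 e2 by (simp add: algebra_simps)
  qed
  ultimately show ?thesis unfolding expands2_def by (simp add: Lim_transform_eventually)
qed

text \<open>
  The Hessian is defined as the derivative of the gradient field; expanding the gradient in the
  standard basis identifies it with the second derivative.
\<close>

lemma inner_hessian_eq_deriv2:
  fixes h :: "'a::euclidean_space \<Rightarrow> real"
  assumes "C2_on_open V h" and "x \<in> V"
  shows "u \<bullet> hessian h x v = deriv2 h x u v"
proof -
  obtain h' h'' where V: "open V"
    and d1: "\<And>y. y \<in> V \<Longrightarrow> (h has_derivative blinfun_apply (h' y)) (at y)"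
    and d2: "\<And>y. y \<in> V \<Longrightarrow> (h' has_derivative blinfun_apply (h'' y)) (at y)"
    and e2: "\<And>y u v. y \<in> V \<Longrightarrow> deriv2 h y u v = h'' y v u"
    using C2_on_openE[OF assms(1)] by metis
  have g: "gradient h y \<bullet> d = h' y d" if "y \<in> V" for y d
    using has_derivative_unique[OF d1[OF that] has_derivative_gradient] d1[OF that]
    unfolding differentiable_def by metis
  have "((\<lambda>y. \<Sum>b\<in>Basis. h' y b *\<^sub>R b) has_derivative (\<lambda>v. \<Sum>b\<in>Basis. h'' x v b *\<^sub>R b)) (at x)"
    by (intro has_derivative_sum has_derivative_scaleR_left
        bounded_linear.has_derivative[OF blinfun.bounded_linear_left] d2[OF assms(2)])
  then have "(gradient h has_derivative (\<lambda>v. \<Sum>b\<in>Basis. h'' x v b *\<^sub>R b)) (at x)"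
    by (rule has_derivative_transform_within_open[OF _ V assms(2)]) (simp add: g[symmetric] euclidean_representation)
  then have "hessian h x = (\<lambda>v. \<Sum>b\<in>Basis. h'' x v b *\<^sub>R b)"
    unfolding hessian_def by (rule frechet_derivative_at[symmetric])
  then have "u \<bullet> hessian h x v = (\<Sum>b\<in>Basis. (u \<bullet> b) * h'' x v b)"
    by (simp add: inner_sum_right mult.commute)
  also have "\<dots> = h'' x v (\<Sum>b\<in>Basis. (u \<bullet> b) *\<^sub>R b)"
    by (simp add: blinfun.sum_right blinfun.scaleR_right)
  finally show ?thesis by (simp add: euclidean_representation e2[OF assms(2)])
qed

section \<open>Quadratic forms on a subspace\<close>

definition quadratic_form_on :: "'a::real_vector set \<Rightarrow> ('a \<Rightarrow> real) \<Rightarrow> bool" where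
  "quadratic_form_on W q \<longleftrightarrow> (\<exists>B. bilinear B \<and> (\<forall>v\<in>W. q v = B v v))"

lemma quadratic_form_on_add:
  assumes "quadratic_form_on W q" and "quadratic_form_on W r"
  shows "quadratic_form_on W (\<lambda>v. q v + r v)"
proof -
  obtain A B where "bilinear A" "bilinear B" "\<forall>v\<in>W. q v = A v v" "\<forall>v\<in>W. r v = B v v"
    using assms unfolding quadratic_form_on_def by blast
  then show ?thesis unfolding quadratic_form_on_def
    by (intro exI[of _ "\<lambda>u v. A u v + B u v"]) (auto simp: bilinear_def linear_compose_add)
qed

lemma quadratic_form_on_linear_bilinear:
  assumes "linear l" and "bilinear B" and "\<forall>v\<in>W. q v = l (B v v)"
  shows "quadratic_form_on W q"
proof -
  have "linear (\<lambda>u. l (B u v))" "linear (\<lambda>v. l (B u v))" for u v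
    using assms(1,2) linear_compose[of "\<lambda>u. B u v" l] linear_compose[of "\<lambda>v. B u v" l]
    by (simp_all add: bilinear_def o_def)
  then have "bilinear (\<lambda>u v. l (B u v))" by (simp add: bilinear_def)
  then show ?thesis using assms(3) unfolding quadratic_form_on_def by blast
qed

lemma quadratic_form_on_scale:
  assumes q: "quadratic_form_on W q" and "subspace W" "v \<in> W"
  shows "q (c *\<^sub>R v) = c\<^sup>2 * q v"
proof -
  obtain B where "bilinear B" "\<forall>v\<in>W. q v = B v v" using q unfolding quadratic_form_on_def by blast
  then show ?thesis using assms(2,3)
    by (simp add: subspace_scale bilinear_lmul bilinear_rmul power2_eq_square)
qed

lemma quadratic_form_on_parallelogram:
  assumes q: "quadratic_form_on W q" and W: "subspace W" "u \<in> W" "v \<in> W"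
  shows "q (u + v) + q (u - v) = 2 * q u + 2 * q v"
proof -
  obtain B where B: "bilinear B" "\<forall>v\<in>W. q v = B v v" using q unfolding quadratic_form_on_def by blast
  then show ?thesis using W
    by (simp add: subspace_add subspace_diff bilinear_ladd[OF B(1)] bilinear_radd[OF B(1)]
        bilinear_lsub[OF B(1)] bilinear_rsub[OF B(1)])
qed

text \<open>
  Around a point \<open>v0\<close> of \<open>C\<close>, the parallelogram identity expresses the value at \<open>s v\<close> through values
  at \<open>v0\<close> and \<open>v0 \<plusminus> s v\<close>, all of which lie in \<open>C\<close> for small \<open>s\<close>. Homogeneity then removes \<open>s\<close>.
\<close>

lemma quadratic_forms_eq_of_eq_on_open:
  fixes W :: "'a::real_normed_vector set"
  assumes W: "subspace W" and q: "quadratic_form_on W q" and r: "quadratic_form_on W r"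
    and C: "openin (top_of_set W) C" "C \<noteq> {}" and eq: "\<And>v. v \<in> C \<Longrightarrow> q v = r v" and v: "v \<in> W"
  shows "q v = r v"
proof -
  obtain O' where O': "open O'" "C = W \<inter> O'" using C(1) unfolding openin_open by blast
  obtain v0 where v0: "v0 \<in> W" "v0 \<in> O'" using C(2) O'(2) by blast
  have "((\<lambda>s. v0 + s *\<^sub>R v) \<longlongrightarrow> v0 + 0 *\<^sub>R v) (at_right 0)" "((\<lambda>s. v0 - s *\<^sub>R v) \<longlongrightarrow> v0 - 0 *\<^sub>R v) (at_right 0)"
    by (intro tendsto_intros)+
  then have "\<forall>\<^sub>F s in at_right 0. v0 + s *\<^sub>R v \<in> O'" "\<forall>\<^sub>F s in at_right 0. v0 - s *\<^sub>R v \<in> O'"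
    using O'(1) v0(2) topological_tendstoD by fastforce+
  then have "\<forall>\<^sub>F s::real in at_right 0. v0 + s *\<^sub>R v \<in> O' \<and> v0 - s *\<^sub>R v \<in> O' \<and> 0 < s"
    using eventually_at_right_less[of 0] by eventually_elim auto
  then obtain s :: real where s: "v0 + s *\<^sub>R v \<in> O'" "v0 - s *\<^sub>R v \<in> O'" "0 < s"
    using eventually_happens' trivial_limit_at_right_real by blast
  have sv: "s *\<^sub>R v \<in> W" using W v by (rule subspace_scale)
  then have "q (v0 + s *\<^sub>R v) = r (v0 + s *\<^sub>R v)" "q (v0 - s *\<^sub>R v) = r (v0 - s *\<^sub>R v)" "q v0 = r v0"
    using s v0 W O'(2) eq subspace_add subspace_diff by blast+
  then have "q (s *\<^sub>R v) = r (s *\<^sub>R v)"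
    using quadratic_form_on_parallelogram[OF q W v0(1) sv] quadratic_form_on_parallelogram[OF r W v0(1) sv]
    by simp
  then show ?thesis
    using quadratic_form_on_scale[OF q W v, of s] quadratic_form_on_scale[OF r W v, of s] s(3) by simp
qed

section \<open>Branch quadratics of accessible strata\<close>

text \<open>
  Since \<open>Q\<close> is quadratic, substituting \<open>t v\<close> into the little-o condition turns it into an expansion
  in \<open>t\<close>. The direction \<open>v = 0\<close> is separate because the condition only concerns nonzero vectors.
\<close>

lemma second_order_parametrization_expands2:
  assumes par: "second_order_parametrization M xbar \<gamma> Q"
    and W: "subspace W" "W \<subseteq> tangent_space M xbar" and v: "v \<in> W"
  shows "expands2 (\<lambda>t. \<gamma> (t *\<^sub>R v)) xbar v (Q v)"
proof (cases "v = 0")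
  case True
  have \<gamma>0: "\<gamma> 0 = xbar" using par by (simp add: second_order_parametrization_def)
  have "Q 0 = 0"
  proof -
    obtain B where "bilinear B" "\<forall>v\<in>tangent_space M xbar. Q v = B v v"
      using par unfolding second_order_parametrization_def by blast
    then show ?thesis using v True W(2) by (metis bilinear_lzero subsetD)
  qed
  then show ?thesis by (simp add: expands2_def True \<gamma>0)
next
  case False
  let ?T = "tangent_space M xbar"
  obtain B where B: "bilinear B" "\<And>v. v \<in> ?T \<Longrightarrow> Q v = B v v"
    using par unfolding second_order_parametrization_def by blast
  have tv: "t *\<^sub>R v \<in> ?T" for t using W v subspace_scale by blast
  then have Q: "Q (t *\<^sub>R v) = t\<^sup>2 *\<^sub>R Q v" for t
    using B(2) B(2)[OF tv[of 1]] by (simp add: bilinear_lmul[OF B(1)] bilinear_rmul[OF B(1)] power2_eq_square)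
  have "((\<lambda>t. t *\<^sub>R v) \<longlongrightarrow> 0 *\<^sub>R v) (at_right 0)" by (intro tendsto_intros)
  then have "filterlim (\<lambda>t. t *\<^sub>R v) (at 0 within ?T) (at_right 0)"
    using eventually_at_right_less[of 0] tv False by (auto simp: filterlim_at elim: eventually_mono)
  note small = this
  have "((\<lambda>v. (\<gamma> v - (xbar + v + Q v)) /\<^sub>R (norm v)\<^sup>2) \<longlongrightarrow> 0) (at 0 within ?T)"
    using par by (simp add: second_order_parametrization_def)
  then have "((\<lambda>t. (\<gamma> (t *\<^sub>R v) - (xbar + t *\<^sub>R v + Q (t *\<^sub>R v))) /\<^sub>R (norm (t *\<^sub>R v))\<^sup>2) \<longlongrightarrow> 0) (at_right 0)"
    using small by (rule filterlim_compose)
  then have "((\<lambda>t. (norm v)\<^sup>2 *\<^sub>R ((\<gamma> (t *\<^sub>R v) - (xbar + t *\<^sub>R v + t\<^sup>2 *\<^sub>R Q v)) /\<^sub>R (norm (t *\<^sub>R v))\<^sup>2)) \<longlongrightarrow> (norm v)\<^sup>2 *\<^sub>R 0) (at_right 0)"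
    unfolding Q by (intro tendsto_intros)
  moreover have "(norm v)\<^sup>2 *\<^sub>R (X /\<^sub>R (norm (t *\<^sub>R v))\<^sup>2) = X /\<^sub>R t\<^sup>2" for X :: 'a and t :: real
    using False by (simp add: power_mult_distrib)
  ultimately show ?thesis unfolding expands2_def by (simp only: scaleR_zero_right)
qed

lemma second_order_parametrization_eventually_mem:
  assumes par: "second_order_parametrization M xbar \<gamma> Q"
    and W: "subspace W" "W \<subseteq> tangent_space M xbar" and v: "v \<in> W"
  shows "\<forall>\<^sub>F t in at_right 0. \<gamma> (t *\<^sub>R v) \<in> M"
proof -
  obtain U where U: "openin (top_of_set (tangent_space M xbar)) U" "0 \<in> U" "\<gamma> ` U \<subseteq> M"
    using par unfolding second_order_parametrization_def by blast
  obtain O' where O': "open O'" "U = tangent_space M xbar \<inter> O'" using U(1) unfolding openin_open by blast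
  have "((\<lambda>t. t *\<^sub>R v) \<longlongrightarrow> 0 *\<^sub>R v) (at_right 0)" by (intro tendsto_intros)
  then have "\<forall>\<^sub>F t in at_right 0. t *\<^sub>R v \<in> O'"
    by (rule topological_tendstoD) (use O' U(2) in auto)
  then show ?thesis
  proof eventually_elim
    case (elim t)
    have "t *\<^sub>R v \<in> tangent_space M xbar" using W v subspace_scale by blast
    then show ?case using elim O'(2) U(3) by blast
  qed
qed

lemma bilinear_deriv2:
  fixes f :: "'a::real_normed_vector \<Rightarrow> 'b::real_normed_vector"
  assumes "C2_on_open V f" and "x \<in> V"
  shows "bilinear (deriv2 f x)"
proof -
  obtain f' :: "'a \<Rightarrow> 'a \<Rightarrow>\<^sub>L 'b" and f'' :: "'a \<Rightarrow> 'a \<Rightarrow>\<^sub>L 'a \<Rightarrow>\<^sub>L 'b"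
    where "\<And>y u v. y \<in> V \<Longrightarrow> deriv2 f y u v = f'' y v u"
    using C2_on_openE[OF assms(1)] by metis
  then have eq: "deriv2 f x = (\<lambda>u v. f'' x v u)" using assms(2) by blast
  show ?thesis unfolding eq bilinear_def
    by (simp add: bounded_linear.linear blinfun.bounded_linear_right
        bounded_linear.linear[OF bounded_linear_compose[OF blinfun.bounded_linear_left blinfun.bounded_linear_right]])
qed

lemma linear_deriv1:
  assumes "C2_on_open V f" and "x \<in> V"
  shows "linear (deriv1 f x)"
  using C11_at_differentiable[OF C2_on_open_imp_C11_at[OF assms]]
  by (rule linear_frechet_derivative)

lemma second_order_coefficient_quadratic_form:
  fixes k :: "'a::real_normed_vector \<Rightarrow> real"
  assumes k: "C2_on_open V k" "x \<in> V" and B: "bilinear B" and Q: "\<forall>v\<in>W. Q v = B v v"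
  shows "quadratic_form_on W (\<lambda>v. deriv1 k x (Q v) + 1/2 * deriv2 k x v v)"
proof (rule quadratic_form_on_add)
  show "quadratic_form_on W (\<lambda>v. deriv1 k x (Q v))"
    by (rule quadratic_form_on_linear_bilinear[OF linear_deriv1[OF k] B]) (use Q in auto)
  show "quadratic_form_on W (\<lambda>v. 1/2 * deriv2 k x v v)"
    by (rule quadratic_form_on_linear_bilinear[where l = "(*) (1/2)", OF _ bilinear_deriv2[OF k]])
       (auto intro: linear_times)
qed

lemma bilinear_compose_linear:
  assumes "bilinear B" and "linear l"
  shows "bilinear (\<lambda>u v. B (l u) (l v))"
proof -
  have "linear (\<lambda>v. B (l u) (l v))" "linear (\<lambda>v. B (l v) (l u))" for u
    using assms linear_compose[OF assms(2), of "B (l u)"] linear_compose[OF assms(2), of "\<lambda>w. B w (l u)"]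
    by (simp_all add: bilinear_def o_def)
  then show ?thesis by (simp add: bilinear_def)
qed

lemma zeta_eq:
  fixes F :: "'a::euclidean_space \<Rightarrow> 'b::euclidean_space"
  assumes "C2_on_open V (g i)" and "F xbar \<in> V"
  shows "zeta F g xbar Q i v = deriv1 (g i) (F xbar) (eta F xbar Q v)
    + 1/2 * deriv2 (g i) (F xbar) (deriv1 F xbar v) (deriv1 F xbar v)"
proof -
  have "deriv1 (g i) (F xbar) = (\<lambda>d. gradient (g i) (F xbar) \<bullet> d)"
    using frechet_derivative_at[OF has_derivative_gradient[OF C11_at_differentiable[OF
      C2_on_open_imp_C11_at[OF assms]]]] by simp
  then show ?thesis by (simp add: zeta_def inner_hessian_eq_deriv2[OF assms])
qed

lemma zeta_quadratic_form:
  fixes F :: "'a::euclidean_space \<Rightarrow> 'b::euclidean_space"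
  assumes F: "C2_on_open U F" "xbar \<in> U" and g: "C2_on_open V (g i)" "F xbar \<in> V"
    and B: "bilinear B" and Q: "\<forall>v\<in>W. Q v = B v v"
  shows "quadratic_form_on W (zeta F g xbar Q i)"
proof -
  have F': "linear (deriv1 F xbar)" and g': "linear (deriv1 (g i) (F xbar))"
    using linear_deriv1 F g by blast+
  have "quadratic_form_on W (\<lambda>v. deriv1 (g i) (F xbar) (deriv1 F xbar (Q v)))"
    by (rule quadratic_form_on_linear_bilinear[OF _ B]) (use linear_compose[OF F' g'] Q in \<open>auto simp: o_def\<close>)
  moreover have "quadratic_form_on W (\<lambda>v. deriv1 (g i) (F xbar) ((1/2) *\<^sub>R deriv2 F xbar v v))"
  proof (rule quadratic_form_on_linear_bilinear)
    show "linear (\<lambda>w. deriv1 (g i) (F xbar) ((1/2) *\<^sub>R w))"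
      using linear_compose[OF linear_scaleR g'] by (simp add: o_def)
  qed (use bilinear_deriv2[OF F] in auto)
  moreover have "quadratic_form_on W (\<lambda>v. 1/2 * deriv2 (g i) (F xbar) (deriv1 F xbar v) (deriv1 F xbar v))"
  proof (rule quadratic_form_on_linear_bilinear)
    show "linear ((*) (1/2 :: real))" by (rule linear_times)
  qed (use bilinear_compose_linear[OF bilinear_deriv2[OF g] F'] in auto)
  ultimately have "quadratic_form_on W (\<lambda>v. deriv1 (g i) (F xbar) (deriv1 F xbar (Q v))
      + deriv1 (g i) (F xbar) ((1/2) *\<^sub>R deriv2 F xbar v v)
      + 1/2 * deriv2 (g i) (F xbar) (deriv1 F xbar v) (deriv1 F xbar v))"
    by (intro quadratic_form_on_add)
  then show ?thesis
    by (simp add: zeta_eq[where g = g and i = i and F = F and xbar = xbar, OF g, abs_def] eta_def linear_add[OF g'])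
qed

text \<open>
  Along the curve through \<open>v\<close>, the functions \<open>g i \<circ> F\<close> and \<open>k\<close> coincide for small positive times,
  the first being active on the stratum and the second extending the restriction of the
  maximum. Their second-order coefficients therefore agree for unit vectors of the accessibility
  cone, by homogeneity on the whole cone, and since both are quadratic forms on all of \<open>W\<close>.
\<close>

lemma zeta_eq_restriction_coefficient:
  fixes F :: "'a::euclidean_space \<Rightarrow> 'b::euclidean_space" and g :: "'i::finite \<Rightarrow> 'b \<Rightarrow> real"
  assumes F: "C2_on UNIV F" and g: "C2_on UNIV (g i)"
    and par: "second_order_parametrization M xbar \<gamma> Q"
    and k: "C2_on_open V k" "xbar \<in> V" "\<And>y. y \<in> M \<inter> V \<Longrightarrow> k y = max_fun g (F y)"
    and W: "subspace W" "W \<subseteq> tangent_space M xbar"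
    and acc: "accessible F \<gamma> W Z" and Z: "\<And>z. z \<in> Z \<Longrightarrow> i \<in> active_set g z"
    and v: "v \<in> W"
  shows "zeta F g xbar Q i v = deriv1 k xbar (Q v) + 1/2 * deriv2 k xbar v v"
proof -
  obtain U where U: "xbar \<in> U" "C2_on_open U F" using C2_on_UNIV_imp_C2_on_open[OF F] by metis
  obtain V' where V': "F xbar \<in> V'" "C2_on_open V' (g i)" using C2_on_UNIV_imp_C2_on_open[OF g] by metis
  obtain B where B: "bilinear B" "\<forall>v\<in>tangent_space M xbar. Q v = B v v"
    using par unfolding second_order_parametrization_def by blast
  then have BW: "\<forall>v\<in>W. Q v = B v v" using W(2) by blast
  define b where "b v = deriv1 k xbar (Q v) + 1/2 * deriv2 k xbar v v" for v
  have qz: "quadratic_form_on W (zeta F g xbar Q i)"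
    by (rule zeta_quadratic_form[where g = g, OF U(2,1) V'(2,1) B(1) BW])
  have qb: "quadratic_form_on W b"
    unfolding b_def by (rule second_order_coefficient_quadratic_form[OF k(1,2) B(1) BW])
  obtain C where C: "C \<noteq> {}" "C \<subseteq> W - {0}" "openin (top_of_set W) C"
    and cone: "\<And>v c. v \<in> C \<Longrightarrow> 0 < c \<Longrightarrow> c *\<^sub>R v \<in> C"
    and unit: "\<And>v. v \<in> C \<Longrightarrow> norm v = 1 \<Longrightarrow> \<exists>\<epsilon>>0. \<forall>t. 0 < t \<and> t < \<epsilon> \<longrightarrow> F (\<gamma> (t *\<^sub>R v)) \<in> Z"
    using acc unfolding accessible_def by metis
  have eq_unit: "zeta F g xbar Q i v = b v" if v: "v \<in> C" "norm v = 1" for v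
  proof -
    have vW: "v \<in> W" using v C(2) by blast
    let ?c = "\<lambda>t. \<gamma> (t *\<^sub>R v)"
    have c: "expands2 ?c xbar v (Q v)"
      by (rule second_order_parametrization_expands2[OF par W vW])
    have "expands2 (\<lambda>t. F (?c t)) (F xbar) (deriv1 F xbar v) (eta F xbar Q v)"
      unfolding eta_def by (rule expands2_C2_compose[OF U(2,1) c])
    from expands2_C2_compose[OF V'(2,1) this]
    have gi: "expands2 (\<lambda>t. g i (F (?c t))) (g i (F xbar)) (deriv1 (g i) (F xbar) (deriv1 F xbar v))
        (zeta F g xbar Q i v)"
      by (simp add: zeta_eq[where g = g and i = i and F = F and xbar = xbar, OF V'(2,1)])
    have kc: "expands2 (\<lambda>t. k (?c t)) (k xbar) (deriv1 k xbar v) (b v)"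
      using expands2_C2_compose[OF k(1,2) c] by (simp add: b_def)
    obtain \<epsilon> where \<epsilon>: "0 < \<epsilon>" "\<And>t. 0 < t \<Longrightarrow> t < \<epsilon> \<Longrightarrow> F (?c t) \<in> Z"
      using unit[OF v] by blast
    have "\<forall>\<^sub>F t in at_right 0. F (?c t) \<in> Z"
      unfolding eventually_at_right_field using \<epsilon> by blast
    moreover have "open V" using k(1) by (simp add: C2_on_open_def)
    then have "\<forall>\<^sub>F t in at_right 0. ?c t \<in> V"
      using topological_tendstoD[OF expands2_tendsto[OF c]] k(2) by blast
    ultimately have "\<forall>\<^sub>F t in at_right 0. g i (F (?c t)) = k (?c t)"
      using second_order_parametrization_eventually_mem[OF par W vW]
    proof eventually_elim
      case (elim t)
      then show ?case using Z[of "F (?c t)"] k(3)[of "?c t"] by (simp add: active_set_def)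
    qed
    then show ?thesis by (rule expands2_unique[OF gi kc])
  qed
  have "zeta F g xbar Q i v = b v" if v: "v \<in> C" for v
  proof -
    have v0: "v \<noteq> 0" "v \<in> W" using v C(2) by auto
    let ?u = "v /\<^sub>R norm v"
    have u: "?u \<in> C" "norm ?u = 1" using cone[OF v, of "inverse (norm v)"] v0(1) by auto
    then have uW: "?u \<in> W" using C(2) by blast
    have "v = norm v *\<^sub>R ?u" using v0 by simp
    then show ?thesis
      using quadratic_form_on_scale[OF qz W(1) uW, of "norm v"] quadratic_form_on_scale[OF qb W(1) uW, of "norm v"]
        eq_unit[OF u] by metis
  qed
  from quadratic_forms_eq_of_eq_on_open[OF W(1) qz qb C(3,1) this v]
  show ?thesis by (simp add: b_def)
qed

lemma stratum_index_eq:
  fixes g :: "'i::finite \<Rightarrow> 'b \<Rightarrow> real"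
  assumes "z \<in> Z" and "\<And>z. z \<in> Z \<Longrightarrow> active_set g z = J"
  shows "stratum_index g Z = J"
  unfolding stratum_index_def using assms by (intro the_equality) auto

text \<open>
  Compatibility constrains a stratum only with respect to index sets active at the base point.
  Accessibility supplies points of the stratum arbitrarily close to the base point, whose active
  set is of this kind; hence it is the active set on the entire stratum.
\<close>

lemma accessible_stratum_active_set:
  fixes F :: "'a::euclidean_space \<Rightarrow> 'b::euclidean_space" and g :: "'i::finite \<Rightarrow> 'b \<Rightarrow> real"
  assumes F: "isCont F xbar" and g: "\<And>i. isCont (g i) (F xbar)"
    and par: "second_order_parametrization M xbar \<gamma> Q"
    and W: "subspace W" "W \<subseteq> tangent_space M xbar"
    and strat: "compatible_stratification g E (F xbar) \<Z>" and Z: "Z \<in> \<Z>"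
    and acc: "accessible F \<gamma> W Z"
  shows "\<And>z. z \<in> Z \<Longrightarrow> active_set g z = stratum_index g Z" and "stratum_index g Z \<noteq> {}"
proof -
  obtain C where C: "C \<noteq> {}" "C \<subseteq> W - {0}"
    and cone: "\<And>v c. v \<in> C \<Longrightarrow> 0 < c \<Longrightarrow> c *\<^sub>R v \<in> C"
    and unit: "\<And>v. v \<in> C \<Longrightarrow> norm v = 1 \<Longrightarrow> \<exists>\<epsilon>>0. \<forall>t. 0 < t \<and> t < \<epsilon> \<longrightarrow> F (\<gamma> (t *\<^sub>R v)) \<in> Z"
    using acc unfolding accessible_def by metis
  obtain w where w: "w \<in> C" using C(1) by blast
  define v where "v = w /\<^sub>R norm w"
  have "w \<noteq> 0" using w C(2) by blast
  then have v: "v \<in> C" "norm v = 1" using cone[OF w, of "inverse (norm w)"] by (auto simp: v_def)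
  then have vW: "v \<in> W" using C(2) by blast
  obtain \<epsilon> where \<epsilon>: "0 < \<epsilon>" "\<And>t. 0 < t \<Longrightarrow> t < \<epsilon> \<Longrightarrow> F (\<gamma> (t *\<^sub>R v)) \<in> Z"
    using unit[OF v] by blast
  have "((\<lambda>t. F (\<gamma> (t *\<^sub>R v))) \<longlongrightarrow> F xbar) (at_right 0)"
    by (intro isCont_tendsto_compose[OF F] expands2_tendsto[OF second_order_parametrization_expands2[OF par W vW]])
  then have "\<forall>\<^sub>F t in at_right 0. active_set g (F (\<gamma> (t *\<^sub>R v))) \<subseteq> active_set g (F xbar)"
    by (rule eventually_compose_filterlim[OF eventually_active_set_subset[where h = g, OF g]])
  moreover have "\<forall>\<^sub>F t in at_right 0. F (\<gamma> (t *\<^sub>R v)) \<in> Z"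
    unfolding eventually_at_right_field using \<epsilon> by blast
  ultimately have "\<forall>\<^sub>F t::real in at_right 0. \<exists>z\<in>Z. active_set g z \<subseteq> active_set g (F xbar)"
    by eventually_elim blast
  then obtain z where z: "z \<in> Z" "active_set g z \<subseteq> active_set g (F xbar)"
    using eventually_happens'[OF trivial_limit_at_right_real] by blast
  have "Z \<subseteq> {y. active_set g y = active_set g z} \<or> Z \<inter> {y. active_set g y = active_set g z} = {}"
    using strat Z z(2) unfolding compatible_stratification_def by blast
  then have all: "active_set g y = active_set g z" if "y \<in> Z" for y using z(1) that by blast
  have "stratum_index g Z = active_set g z" by (rule stratum_index_eq[OF z(1) all])
  then show "\<And>z. z \<in> Z \<Longrightarrow> active_set g z = stratum_index g Z" "stratum_index g Z \<noteq> {}"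
    using all active_set_nonempty[of g z] by auto
qed

theorem theorem3p9:
  fixes S :: "nat \<Rightarrow> real list set set"
    and F :: "real ^ 'd \<Rightarrow> real ^ 'n"
    and g :: "'i::finite \<Rightarrow> real ^ 'n \<Rightarrow> real"
    and xbar :: "real ^ 'd"
    and \<Z> :: "(real ^ 'n) set set"
    and \<gamma> Q :: "real ^ 'd \<Rightarrow> real ^ 'd"
  defines "f \<equiv> max_fun g \<circ> F"
    and "zbar \<equiv> F xbar"
    and "E \<equiv> critical_active_region F g xbar"
    and "M \<equiv> minimal_identifiable_set F g xbar"
  assumes "o_minimal_structure S"
    and "definable_map S F" and "C2_on UNIV F"
    and "\<And>i. definable_map S (g i)" and "\<And>i. C2_on UNIV (g i)"
    and "critical_point f xbar"
    and "compatible_stratification g E zbar \<Z>"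
    and "C2_identifiable_manifold f xbar 0 M \<Longrightarrow> second_order_parametrization M xbar \<gamma> Q"
    and "C2_identifiable_manifold f xbar 0 M \<Longrightarrow>
      \<exists>W Z1 Z2. subspace W \<and> W \<subseteq> tangent_space M xbar \<and> Z1 \<in> \<Z> \<and> Z2 \<in> \<Z> \<and>
        accessible F \<gamma> W Z1 \<and> accessible F \<gamma> W Z2 \<and>
        (\<exists>v\<in>W. branch_quadratic F g xbar Q Z1 v \<noteq> branch_quadratic F g xbar Q Z2 v)"
  shows "inactive f xbar"
  unfolding inactive_def
proof (intro conjI notI)
  show "critical_point f xbar" by fact
  note F = \<open>C2_on UNIV F\<close> and g = \<open>\<And>i. C2_on UNIV (g i)\<close>
  define h where "h = (\<lambda>i. g i \<circ> F)"
  have F1: "C11_at F y" for y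
    using C2_on_UNIV_imp_C2_on_open[OF F, of y] C2_on_open_imp_C11_at by metis
  have g1: "C11_at (g i) z" for i z
    using C2_on_UNIV_imp_C2_on_open[OF g[of i], of z] C2_on_open_imp_C11_at by metis
  have h1: "C11_at (h i) y" for i y unfolding h_def by (rule C11_at_compose[OF F1 g1])
  have f: "f = max_fun h" unfolding f_def h_def by (rule max_fun_compose)
  have M: "M = critical_region h xbar"
    unfolding M_def h_def
    by (rule minimal_identifiable_set_eq_critical_region) (intro C11_at_differentiable F1 g1)+
  assume "\<exists>M. C2_identifiable_manifold f xbar 0 M"
  then have man: "C2_identifiable_manifold f xbar 0 M"
    unfolding f M using identifiable_manifold_imp_critical_region_manifold[where h = h, OF h1] by blast
  note par = assms(12)[OF man]
  obtain W Z1 Z2 v where W: "subspace W" "W \<subseteq> tangent_space M xbar"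
    and Z: "Z1 \<in> \<Z>" "Z2 \<in> \<Z>" and acc: "accessible F \<gamma> W Z1" "accessible F \<gamma> W Z2"
    and v: "v \<in> W" "branch_quadratic F g xbar Q Z1 v \<noteq> branch_quadratic F g xbar Q Z2 v"
    using assms(13)[OF man] by blast
  obtain U where U: "open U" "xbar \<in> U" "C2_on (M \<inter> U) f"
    using man unfolding C2_identifiable_manifold_def by blast
  have "xbar \<in> M \<inter> U" using man U(2) by (simp add: C2_identifiable_manifold_def identifiable_def)
  then obtain V k where V: "xbar \<in> V" "C2_on_open V k" "\<And>y. y \<in> M \<inter> U \<inter> V \<Longrightarrow> k y = f y"
    using U(3) unfolding C2_on_def by metis
  have "open V" using V(2) by (simp add: C2_on_open_def)
  then have k: "C2_on_open (U \<inter> V) k" "xbar \<in> U \<inter> V" "\<And>y. y \<in> M \<inter> (U \<inter> V) \<Longrightarrow> k y = max_fun g (F y)"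
    using V U C2_on_open_subset[OF V(2), of "U \<inter> V"] by (auto simp: f_def)
  have "branch_quadratic F g xbar Q Z v = deriv1 k xbar (Q v) + 1/2 * deriv2 k xbar v v"
    if Z: "Z \<in> \<Z>" "accessible F \<gamma> W Z" for Z
  proof -
    note index = accessible_stratum_active_set[where g = g, OF C11_at_isCont[OF F1] C11_at_isCont[OF g1] par W
        assms(11)[unfolded zbar_def] Z]
    have "zeta F g xbar Q i v = deriv1 k xbar (Q v) + 1/2 * deriv2 k xbar v v" if "i \<in> stratum_index g Z" for i
      by (rule zeta_eq_restriction_coefficient[where g = g, OF F g par k W Z(2) _ v(1)]) (use index(1) that in auto)
    then show ?thesis unfolding branch_quadratic_def using index(2) by (intro the_equality) auto
  qed
  then show False using v(2) Z acc by metis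
qed

end
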